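(* Let $Z^h_{\widehat{\Sigma\operatorname{Lie}}}(t,p_1,p_2,\ldots)$ be the weighted cycle index series of hollow hypertrees decorated by $\widehat{\Sigma\operatorname{Lie}}$ and let $\Lambda(t,p_1,p_2,\ldots)$ be the cycle index series of the operad $\Lambda$. Then $$Z^h_{\widehat{\Sigma \operatorname{Lie}}}(t, p_1, p_2, \ldots, p_i, \ldots) = t^{-1} \Lambda(t^{-1},t p_1, \ldots, t^i p_i, \ldots) = \Sigma\, \Sigma_t\, \Lambda(t^{-1}, p_1,p_2, \ldots).$$
   Context: All series are symmetric functions (formal power series in $p_1,p_2,\ldots$) with coefficients in $\mathbb{Q}[t,t^{-1}]$. Plethysm: $f\circ g$ is obtained from $f$ by replacing each $p_k$ by $p_k\circ g$, where $p_k\circ g$ is $g$ with $p_i\mapsto p_{ki}$, $t\mapsto t^k$ (scalars in $\mathbb Q$, including signs, unchanged). The suspension is $\Sigma_t f=-\frac1t f(-tp_1,-t^2p_2,-t^3p_3,\ldots)$, where only the $p_i$ are changed (a parameter $t$ or $t^{-1}$ in the coefficients of $f$ is left fixed), and $\Sigma f=-f(-p_1,-p_2,\ldots)$ is the case $t=1$. $\operatorname{Comm}=\exp\bigl(\sum_{k\ge1}p_k/k\bigr)-1$ and $\operatorname{Lie}=-\sum_{k\ge1}\frac{\mu(k)}{k}\log(1-p_k)$, with $\mu$ the Möbius function; $\Sigma\operatorname{Lie}=\sum_{k\ge1}\frac{\mu(k)}k\log(1+p_k)$, which satisfies $\operatorname{Comm}\circ\Sigma\operatorname{Lie}=p_1$.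 Hollow hypertrees decorated by $\widehat{\Sigma\operatorname{Lie}}$: A hypertree on a finite non-empty set $V$ is a pair $(V,E)$, $E$ a set of subsets of $V$ of cardinality $\ge2$ (edges), whose bipartite incidence graph is a tree; a hollow hypertree on $I$ is a hypertree on $\{\#\}\sqcup I$ with $\#$ in exactly one edge. The petiole of an edge is its vertex nearest to $\#$ (which is $\#$ for the edge containing it). The decoration puts on each edge a (virtual, linear) $\Sigma\operatorname{Lie}$-structure on its vertices other than the petiole, and the weight is $t^{|E|-1}$. Its cycle index series $Z^h=Z^h_{\widehat{\Sigma\operatorname{Lie}}}$ is the unique series without constant term satisfying $Z^h=\Sigma\operatorname{Lie}\circ\bigl(p_1+p_1\times\operatorname{Comm}\circ(t\,Z^h)\bigr)$. The operad $\Lambda$: $\operatorname{Pasc}$ is the symmetric graded operad of F. Chapoton (Opérades différentielles graduées sur les simplexes et les permutoèdres, Bull. SMF 2002), a binary quadratic operad with explicit basis indexed by non-empty subsets, whose graded cycle index series ($t$ recording the grading) is $\operatorname{Pasc}=(1+\operatorname{Comm})\times\Sigma_t\operatorname{Comm}$. $\Lambda$ is the quadratic dual operad of $\operatorname{Pasc}$. These operads are Koszul (a result of V. Dotsenko, taken as known), so that the graded cycle index series $\Lambda=\Lambda(t,p_1,p_2,\ldots)$ is the plethystic inverse of $\Sigma\operatorname{Pasc}$: $\Sigma\operatorname{Pasc}\circ\Lambda=p_1$. *)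

theory Defs
  imports
    "HOL-Library.Poly_Mapping"
    "HOL-Library.Multiset"
    "HOL-Computational_Algebra.Formal_Power_Series"
    "HOL-Computational_Algebra.Squarefree"
begin

text \<open>
  Laurent polynomials in \<open>t\<close> over \<open>\<rat>\<close>: the key \<open>n\<close> is the exponent of \<open>t\<close>, and the product
  of \<^typ>\<open>(int, rat) poly_mapping\<close> is convolution.
\<close>

type_synonym laurent = "(int, rat) poly_mapping"

definition t_power :: "int \<Rightarrow> laurent"
  where "t_power n = Poly_Mapping.single n 1"

definition rat_const :: "rat \<Rightarrow> laurent"
  where "rat_const q = Poly_Mapping.single 0 q"

text \<open>The substitution \<open>t \<mapsto> t^k\<close>; \<open>k\<close> may be negative.\<close>

definition subst_t :: "int \<Rightarrow> laurent \<Rightarrow> laurent"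
  where "subst_t k q =
    (\<Sum>n\<in>Poly_Mapping.keys q. Poly_Mapping.single (k * n) (Poly_Mapping.lookup q n))"

lemma subst_t_0 [simp]: "subst_t k 0 = 0"
  by (simp add: subst_t_def)

text \<open>
  The monomials in \<open>p\<^sub>1, p\<^sub>2, \<dots>\<close> are the products \<open>\<Prod>k\<in>#m. p\<^sub>k\<close> over
  the finite multisets \<open>m\<close> of positive integers. To avoid a separate type of positive
  integers, all multisets of naturals are allowed as keys, and a series vanishes on those
  which contain \<open>0\<close>.
\<close>

typedef symfun = "{f :: nat multiset \<Rightarrow> laurent. \<forall>m. 0 \<in># m \<longrightarrow> f m = 0}"
  morphisms coeff Symfun
  by (rule exI[of _ "\<lambda>_. 0"]) simp

setup_lifting type_definition_symfun

text \<open>Keeps \<^typ>\<open>laurent\<close> opaque in the lifted definitions below.\<close>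

lifting_forget poly_mapping.lifting

lemma symfun_eqI: "(\<And>m. coeff f m = coeff g m) \<Longrightarrow> f = g"
  by transfer auto

lemma finite_mset_splittings: "finite {(a, b). a + b = (m :: 'a multiset)}"
proof (rule finite_subset)
  have *: "a \<in> mset ` {xs. set xs \<subseteq> set_mset m \<and> length xs \<le> size m}"
    if "a \<subseteq># m" for a
  proof -
    obtain xs where "a = mset xs" by (metis ex_mset)
    with that show ?thesis
      by (metis (mono_tags, lifting) image_eqI mem_Collect_eq set_mset_mono set_mset_mset
          size_mset size_mset_mono)
  qed
  show "{(a, b). a + b = m} \<subseteq>
      (mset ` {xs. set xs \<subseteq> set_mset m \<and> length xs \<le> size m}) \<times>
      (mset ` {xs. set xs \<subseteq> set_mset m \<and> length xs \<le> size m})"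
    using * by fastforce
  show "finite ((mset ` {xs. set xs \<subseteq> set_mset m \<and> length xs \<le> size m}) \<times>
      (mset ` {xs. set xs \<subseteq> set_mset m \<and> length xs \<le> size m}))"
    by (intro finite_cartesian_product finite_imageI finite_lists_length_le) simp_all
qed

instantiation symfun :: comm_ring_1
begin

lift_definition zero_symfun :: symfun is "\<lambda>_. 0" by simp

lift_definition one_symfun :: symfun is "\<lambda>m. if m = {#} then 1 else 0" by auto

lift_definition plus_symfun :: "symfun \<Rightarrow> symfun \<Rightarrow> symfun" is "\<lambda>f g m. f m + g m" by simp

lift_definition minus_symfun :: "symfun \<Rightarrow> symfun \<Rightarrow> symfun" is "\<lambda>f g m. f m - g m" by simp

lift_definition uminus_symfun :: "symfun \<Rightarrow> symfun" is "\<lambda>f m. - f m" by simp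

lift_definition times_symfun :: "symfun \<Rightarrow> symfun \<Rightarrow> symfun"
  is "\<lambda>f g m. \<Sum>(a, b) | a + b = m. f a * g b"
  by (intro sum.neutral) auto

instance
proof
  fix f g h :: symfun
  show "f * g * h = f * (g * h)"
  proof (rule symfun_eqI)
    fix m
    let ?S = "\<lambda>x :: nat multiset. {p. fst p + snd p = x}"
    have fin: "finite (?S x)" for x
      by (rule finite_subset[OF _ finite_mset_splittings[of x]]) auto
    have "coeff (f * g * h) m =
        (\<Sum>p\<in>?S m. \<Sum>q\<in>?S (fst p). coeff f (fst q) * coeff g (snd q) * coeff h (snd p))"
      by (simp add: times_symfun.rep_eq sum_distrib_right split_def)
    also have "\<dots> = (\<Sum>(p, q)\<in>Sigma (?S m) (\<lambda>p. ?S (fst p)).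
        coeff f (fst q) * coeff g (snd q) * coeff h (snd p))"
      by (rule sum.Sigma) (auto simp: fin)
    also have "\<dots> = (\<Sum>(p, q)\<in>Sigma (?S m) (\<lambda>p. ?S (snd p)).
        coeff f (fst p) * coeff g (fst q) * coeff h (snd q))"
      by (rule sum.reindex_bij_witness[of _
            "\<lambda>((a, y), (b, c)). ((a + b, c), (a, b))" "\<lambda>((x, c), (a, b)). ((a, b + c), (b, c))"])
        (auto simp: add.assoc)
    also have "\<dots> =
        (\<Sum>p\<in>?S m. \<Sum>q\<in>?S (snd p). coeff f (fst p) * coeff g (fst q) * coeff h (snd q))"
      by (rule sum.Sigma[symmetric]) (auto simp: fin)
    also have "\<dots> = coeff (f * (g * h)) m"
      by (simp add: times_symfun.rep_eq sum_distrib_left split_def mult.assoc)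
    finally show "coeff (f * g * h) m = coeff (f * (g * h)) m" .
  qed
  show "f * g = g * f"
  proof (rule symfun_eqI)
    fix m
    show "coeff (f * g) m = coeff (g * f) m"
      unfolding times_symfun.rep_eq
      by (rule sum.reindex_bij_witness[of _ "\<lambda>(a, b). (b, a)" "\<lambda>(a, b). (b, a)"])
        (auto simp: add.commute mult.commute)
  qed
  show "1 * f = f"
  proof (rule symfun_eqI)
    fix m
    have "coeff (1 * f) m = (\<Sum>(a, b)\<in>{({#}, m)}. coeff 1 a * coeff f b)"
      unfolding times_symfun.rep_eq
      by (rule sum.mono_neutral_right)
        (auto simp: one_symfun.rep_eq finite_mset_splittings split: if_splits)
    then show "coeff (1 * f) m = coeff f m" by (simp add: one_symfun.rep_eq)
  qed
  show "(f + g) * h = f * h + g * h"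
    by (rule symfun_eqI)
      (simp add: times_symfun.rep_eq plus_symfun.rep_eq split_def distrib_right sum.distrib)
  show "f + g + h = f + (g + h)" "f + g = g + f" "0 + f = f" "- f + f = 0" "f - g = f + - g"
    by (transfer; auto simp: fun_eq_iff algebra_simps)+
  show "(0 :: symfun) \<noteq> 1"
    by transfer (metis zero_neq_one)
qed

end

lift_definition power_sum :: "nat \<Rightarrow> symfun"
  is "\<lambda>k m. if 0 < k \<and> m = {#k#} then 1 else 0" by auto

lift_definition smult :: "laurent \<Rightarrow> symfun \<Rightarrow> symfun" is "\<lambda>c f m. c * f m" by simp

text \<open>
  Coefficientwise sum of a family of series. It is meant for families in which every
  coefficient is nonzero for only finitely many members; otherwise that coefficient is \<open>0\<close>.
\<close>

lift_definition formal_sum :: "('i \<Rightarrow> symfun) \<Rightarrow> 'i set \<Rightarrow> symfun"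
  is "\<lambda>F A m. \<Sum>i | i \<in> A \<and> F i m \<noteq> 0. F i m"
  by simp

text \<open>
  \<open>F(f) = \<Sum>n. F\<^sub>n f^n\<close> for a univariate power series \<open>F\<close> over \<open>\<rat>\<close> and a
  series \<open>f\<close> without constant term.
\<close>

definition fps_subst :: "rat fps \<Rightarrow> symfun \<Rightarrow> symfun"
  where "fps_subst F f = formal_sum (\<lambda>n. smult (rat_const (fps_nth F n)) (f ^ n)) UNIV"

text \<open>The substitution \<open>p\<^sub>i \<mapsto> c\<^sub>i p\<^sub>i\<close>, with the coefficients left fixed.\<close>

lift_definition rescale :: "(nat \<Rightarrow> laurent) \<Rightarrow> symfun \<Rightarrow> symfun"
  is "\<lambda>c f m. (\<Prod>i\<in>#m. c i) * f m" by simp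

text \<open>The substitution \<open>t \<mapsto> t^k\<close> in the coefficients, with the \<open>p\<^sub>i\<close> left fixed.\<close>

lift_definition subst_t_coeffs :: "int \<Rightarrow> symfun \<Rightarrow> symfun"
  is "\<lambda>k f m. subst_t k (f m)" by simp

text \<open>
  \<open>adams k g\<close> is \<open>p\<^sub>k \<circ> g\<close>, that is \<open>g\<close> with \<open>p\<^sub>i \<mapsto> p\<^bsub>ki\<^esub>\<close> and \<open>t \<mapsto> t^k\<close>, for \<open>k > 0\<close>.
  The monomials that occur in it are those whose parts are all divisible by \<open>k\<close>.
\<close>

lift_definition adams :: "nat \<Rightarrow> symfun \<Rightarrow> symfun"
  is "\<lambda>k g m. if \<forall>i\<in>#m. k dvd i then subst_t (int k) (g (image_mset (\<lambda>i. i div k) m)) else 0"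
  by (auto simp: image_iff) (metis div_0 subst_t_0 image_eqI set_image_mset)

text \<open>Meaningful for \<open>g\<close> without constant term.\<close>

definition plethysm :: "symfun \<Rightarrow> symfun \<Rightarrow> symfun"  (infixl \<open>\<circ>\<^sub>p\<close> 75)
  where "f \<circ>\<^sub>p g = formal_sum (\<lambda>m. smult (coeff f m) (\<Prod>k\<in>#m. adams k g)) UNIV"

text \<open>
  Only the \<open>p\<^sub>i\<close> are changed by the suspensions, also when \<open>t\<close> occurs in the coefficients
  of \<open>f\<close>. The untwisted suspension is written \<open>\<Sigma>\<^sub>1\<close>, because it is the case \<open>t = 1\<close>.
\<close>

definition suspension_t :: "symfun \<Rightarrow> symfun"  (\<open>\<Sigma>\<^sub>t\<close>)
  where "\<Sigma>\<^sub>t f = smult (- t_power (- 1)) (rescale (\<lambda>i. - t_power (int i)) f)"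

definition suspension :: "symfun \<Rightarrow> symfun"  (\<open>\<Sigma>\<^sub>1\<close>)
  where "\<Sigma>\<^sub>1 f = - rescale (\<lambda>_. - 1) f"

definition moebius :: "nat \<Rightarrow> rat"
  where "moebius k = (if squarefree k then (- 1) ^ card (prime_factors k) else 0)"

definition Comm :: symfun
  where "Comm =
    fps_subst (fps_exp 1)
      (formal_sum (\<lambda>k. smult (rat_const (1 / of_nat k)) (power_sum k)) {1..}) - 1"

text \<open>\<^term>\<open>fps_ln 1 :: rat fps\<close> is the expansion of \<open>log (1 + x)\<close>.\<close>

definition Lie :: symfun
  where "Lie =
    - formal_sum
        (\<lambda>k. smult (rat_const (moebius k / of_nat k)) (fps_subst (fps_ln 1) (- power_sum k))) {1..}"

text \<open>
  The graded cycle index series of Chapoton's operad Pasc, whose components have a basis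
  indexed by the non-empty subsets of the set of inputs; \<open>t\<close> records the grading.
\<close>

definition Pasc :: symfun
  where "Pasc = (1 + Comm) * \<Sigma>\<^sub>t Comm"

text \<open>
  The operad \<open>\<Lambda>\<close> is the quadratic dual of the operad with series \<^const>\<open>Pasc\<close>. By Koszulness
  its graded cycle index series is the plethystic inverse of the suspension of \<^const>\<open>Pasc\<close>.
\<close>

definition Lambda :: symfun  (\<open>\<Lambda>\<close>)
  where "\<Lambda> = (THE L. coeff L {#} = 0 \<and> \<Sigma>\<^sub>1 Pasc \<circ>\<^sub>p L = power_sum 1)"

text \<open>
  The cycle index series of hollow hypertrees, weighted by \<open>t\<close> to the number of edges minus
  one, in which every edge carries a (virtual) \<open>\<Sigma>Lie\<close>-structure on its vertices other than the
  petiole. As \<open>\<Sigma>Lie\<close> is only a virtual species, the series is the one determined by the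
  decomposition at the edge containing the root \<open>#\<close>: every other vertex of that edge is a
  label carrying a possibly empty set of hollow hypertrees, each of them contributing a factor
  \<open>t\<close> because of the normalisation of the weight.
\<close>

definition Zh_SigmaLie :: symfun
  where "Zh_SigmaLie =
    (THE Z. coeff Z {#} = 0 \<and>
      Z = \<Sigma>\<^sub>1 Lie \<circ>\<^sub>p (power_sum 1 + power_sum 1 * (Comm \<circ>\<^sub>p smult (t_power 1) Z)))"

end

theory Submission
  imports Defs
begin

text \<open>
  Write \<open>E = 1 + Comm\<close>. Plethysm by a series without constant term is a ring homomorphism that
  commutes with infinite sums, so \<open>E \<circ> f = exp (\<Sum>k\<ge>1. (p\<^sub>k \<circ> f) / k)\<close>, and \<open>E \<circ> (- f)\<close> is the inverse of
  \<open>E \<circ> f\<close>. Since \<open>\<Sigma>Pasc = t\<^sup>-\<^sup>1 E(- p) (E(t p) - 1)\<close>, the equation \<open>\<Sigma>Pasc \<circ> \<Lambda> = p\<^sub>1\<close> says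
  \<open>E \<circ> (t \<Lambda>) - 1 = t p\<^sub>1 (E \<circ> \<Lambda>)\<close>. Since \<open>Comm\<close> and \<open>\<Sigma>Lie\<close> are plethystic inverses, the equation for the
  hollow hypertrees says \<open>E \<circ> Z - 1 = p\<^sub>1 (E \<circ> (t Z))\<close>. The involution \<open>t \<mapsto> t\<^sup>-\<^sup>1\<close>, \<open>p\<^sub>i \<mapsto> t\<^sup>i p\<^sub>i\<close>
  commutes with plethysm from the left by \<open>Comm\<close> and carries the first equation to the second under
  \<open>Z = t\<^sup>-\<^sup>1 \<Lambda>(t\<^sup>-\<^sup>1, t p\<^sub>1, t\<^sup>2 p\<^sub>2, \<dots>)\<close>. The equation for \<open>Z\<close> is contracting for the grading by
  \<open>deg p\<^sub>k = k\<close>, hence both solutions exist and are unique.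
\<close>

section \<open>Laurent polynomials and the substitution t -> t^k\<close>

lemma subst_t_eq_sum:
  assumes "finite S" "Poly_Mapping.keys q \<subseteq> S"
  shows "subst_t k q = (\<Sum>n\<in>S. Poly_Mapping.single (k * n) (Poly_Mapping.lookup q n))"
  unfolding subst_t_def
  by (rule sum.mono_neutral_left) (use assms in \<open>auto simp: in_keys_iff\<close>)

lemma subst_t_add: "subst_t k (p + q) = subst_t k p + subst_t k q"
proof -
  \<comment> \<open>Keys may cancel in \<open>p + q\<close>, so all three sums are taken over one
    common set.\<close>
  let ?S = "Poly_Mapping.keys p \<union> Poly_Mapping.keys q"
  have "Poly_Mapping.keys (p + q) \<subseteq> ?S"
    by (rule keys_add)
  then show ?thesis
    by (simp add: subst_t_eq_sum[of ?S] lookup_add single_add sum.distrib)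
qed

lemma subst_t_single: "subst_t k (Poly_Mapping.single n c) = Poly_Mapping.single (k * n) c"
  by (subst subst_t_eq_sum[of "{n}"]) (auto simp: lookup_single split: if_splits)

lemma subst_t_sum: "subst_t k (\<Sum>i\<in>A. f i) = (\<Sum>i\<in>A. subst_t k (f i))"
  by (induction A rule: infinite_finite_induct) (auto simp: subst_t_add)

lemma laurent_eq_sum_singles:
  "(q :: laurent) = (\<Sum>n\<in>Poly_Mapping.keys q. Poly_Mapping.single n (Poly_Mapping.lookup q n))"
  by (rule poly_mapping_eqI)
    (auto simp: lookup_sum lookup_single when_def in_keys_iff)

text \<open>Monomials generate the Laurent polynomials additively, so identities that are additive
  in each argument, such as multiplicativity of \<open>subst_t\<close>, can be checked on
  monomials.\<close>

lemma laurent_induct [case_names single add]: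
  assumes "\<And>n c. P (Poly_Mapping.single n c)" "\<And>p q. P p \<Longrightarrow> P q \<Longrightarrow> P (p + q)"
  shows "P (q :: laurent)"
proof -
  have "P (\<Sum>n\<in>A. Poly_Mapping.single n (Poly_Mapping.lookup q n))" for A
  proof (induction A rule: infinite_finite_induct)
    case (infinite A)
    \<comment> \<open>Zero is covered as a monomial with coefficient 0.\<close>
    then show ?case using assms(1)[of 0 0] by simp
  next
    case empty
    then show ?case using assms(1)[of 0 0] by simp
  qed (auto intro: assms)
  then show ?thesis
    by (subst laurent_eq_sum_singles)
qed

lemma subst_t_mult: "subst_t k (p * q) = subst_t k p * subst_t k q"
proof (induction p rule: laurent_induct)
  case (single n c)
  show ?case
    by (induction q rule: laurent_induct)
      (auto simp: mult_single subst_t_single subst_t_add algebra_simps)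
qed (auto simp: subst_t_add algebra_simps)

lemma subst_t_subst_t: "subst_t j (subst_t k q) = subst_t (j * k) q"
  by (induction q rule: laurent_induct) (auto simp: subst_t_single subst_t_add mult.assoc)

lemma subst_t_id [simp]: "subst_t 1 q = q"
  by (induction q rule: laurent_induct) (auto simp: subst_t_single subst_t_add)

lemma subst_t_rat_const [simp]: "subst_t k (rat_const c) = rat_const c"
  by (simp add: rat_const_def subst_t_single)

lemma subst_t_t_power [simp]: "subst_t k (t_power n) = t_power (k * n)"
  by (simp add: t_power_def subst_t_single)

lemma t_power_0 [simp]: "t_power 0 = 1"
  by (simp add: t_power_def)

lemma t_power_mult: "t_power m * t_power n = t_power (m + n)"
  by (simp add: t_power_def mult_single)

lemma t_power_mult_cancel [simp]: "t_power n * t_power (- n) = 1" "t_power (- n) * t_power n = 1"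
  by (simp_all add: t_power_mult)

lemma rat_const_0 [simp]: "rat_const 0 = 0"
  by (simp add: rat_const_def)

lemma rat_const_1 [simp]: "rat_const 1 = 1"
  by (simp add: rat_const_def)

lemma subst_t_1 [simp]: "subst_t k 1 = 1"
  using subst_t_rat_const[of k 1] by simp

lemma rat_const_add: "rat_const (a + b) = rat_const a + rat_const b"
  by (simp add: rat_const_def single_add)

lemma rat_const_uminus: "rat_const (- a) = - rat_const a"
  by (simp add: rat_const_def single_uminus)

lemma rat_const_mult: "rat_const (a * b) = rat_const a * rat_const b"
  by (simp add: rat_const_def mult_single)

lemma rat_const_sum: "rat_const (\<Sum>i\<in>A. f i) = (\<Sum>i\<in>A. rat_const (f i))"
  by (induction A rule: infinite_finite_induct) (auto simp: rat_const_add)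

section \<open>Coefficients and scalar multiples of symmetric functions\<close>

lemma coeff_0 [simp]: "coeff 0 m = 0"
  by (simp add: zero_symfun.rep_eq)

lemma coeff_1: "coeff 1 m = (if m = {#} then 1 else 0)"
  by (simp add: one_symfun.rep_eq)

lemma coeff_add [simp]: "coeff (f + g) m = coeff f m + coeff g m"
  by (simp add: plus_symfun.rep_eq)

lemma coeff_diff [simp]: "coeff (f - g) m = coeff f m - coeff g m"
  by (simp add: minus_symfun.rep_eq)

lemma coeff_uminus [simp]: "coeff (- f) m = - coeff f m"
  by (simp add: uminus_symfun.rep_eq)

lemma coeff_smult [simp]: "coeff (smult c f) m = c * coeff f m"
  by (simp add: smult.rep_eq)

lemma coeff_mult: "coeff (f * g) m = (\<Sum>(a, b) | a + b = m. coeff f a * coeff g b)"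
  by (simp add: times_symfun.rep_eq)

lemma coeff_sum [simp]: "coeff (\<Sum>i\<in>A. F i) m = (\<Sum>i\<in>A. coeff (F i) m)"
  by (induction A rule: infinite_finite_induct) auto

lemma coeff_rescale [simp]: "coeff (rescale c f) m = (\<Prod>i\<in>#m. c i) * coeff f m"
  by (simp add: rescale.rep_eq)

lemma coeff_subst_t_coeffs [simp]: "coeff (subst_t_coeffs k f) m = subst_t k (coeff f m)"
  by (simp add: subst_t_coeffs.rep_eq)

lemma coeff_power_sum: "coeff (power_sum k) m = (if 0 < k \<and> m = {#k#} then 1 else 0)"
  by (simp add: power_sum.rep_eq)

lemma coeff_eq_0: "0 \<in># m \<Longrightarrow> coeff f m = 0"
  by transfer auto

lemma coeff_mult_Nil [simp]: "coeff (f * g) {#} = coeff f {#} * coeff g {#}"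
proof -
  have "{(a, b). a + b = ({#} :: nat multiset)} = {({#}, {#})}"
    by auto
  then show ?thesis
    by (simp add: coeff_mult)
qed

lemma smult_simps:
  "smult 1 f = f" "smult 0 f = 0" "smult c 0 = 0" "smult (- c) f = - smult c f"
  "smult c (- f) = - smult c f" "smult c (smult d f) = smult (c * d) f"
  "smult c (f + g) = smult c f + smult c g" "smult c (f - g) = smult c f - smult c g"
  "smult (c + d) f = smult c f + smult d f"
  by (rule symfun_eqI; simp add: algebra_simps)+

lemma smult_sum_left: "smult (\<Sum>i\<in>A. c i) f = (\<Sum>i\<in>A. smult (c i) f)"
  by (rule symfun_eqI) (simp add: sum_distrib_right)

lemma smult_mult_left: "smult c f * g = smult c (f * g)"
  by (rule symfun_eqI) (simp add: coeff_mult sum_distrib_left split_def mult.assoc)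

lemma smult_mult_right: "f * smult c g = smult c (f * g)"
  by (metis smult_mult_left mult.commute)

lemma smult_t_power_cancel:
  "smult (t_power n) (smult (t_power (- n)) f) = f"
  "smult (t_power (- n)) (smult (t_power n) f) = f"
  by (simp_all add: smult_simps)

section \<open>Infinite sums of symmetric functions\<close>

text \<open>Summability. Off this condition \<open>formal_sum\<close> takes the default value 0 at a
  coefficient with infinitely many contributions, so additivity and Fubini are proved under
  it.\<close>

definition locally_finite :: "('i \<Rightarrow> symfun) \<Rightarrow> 'i set \<Rightarrow> bool"
  where "locally_finite F A \<longleftrightarrow> (\<forall>m. finite {i \<in> A. coeff (F i) m \<noteq> 0})"

text \<open>Any finite \<open>S\<close> containing the contributing indices may be chosen, which
  reduces each coefficient to an ordinary finite sum.\<close>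

lemma coeff_formal_sum:
  assumes "finite S" "S \<subseteq> A" "\<And>i. i \<in> A - S \<Longrightarrow> coeff (F i) m = 0"
  shows "coeff (formal_sum F A) m = (\<Sum>i\<in>S. coeff (F i) m)"
  unfolding formal_sum.rep_eq
  by (rule sum.mono_neutral_left) (use assms in auto)

lemma formal_sum_finite: "finite A \<Longrightarrow> formal_sum F A = (\<Sum>i\<in>A. F i)"
  by (rule symfun_eqI) (subst coeff_formal_sum[of A A], auto)

lemma formal_sum_cong:
  assumes "A = B" "\<And>i. i \<in> B \<Longrightarrow> F i = G i"
  shows "formal_sum F A = formal_sum G B"
proof (rule symfun_eqI)
  fix m
  have "{i \<in> A. coeff (F i) m \<noteq> 0} = {i \<in> B. coeff (G i) m \<noteq> 0}"
    using assms by auto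
  then show "coeff (formal_sum F A) m = coeff (formal_sum G B) m"
    using assms by (auto simp: formal_sum.rep_eq intro!: sum.cong)
qed

lemma formal_sum_reindex:
  assumes "bij_betw h A B"
  shows "formal_sum F B = formal_sum (\<lambda>i. F (h i)) A"
proof (rule symfun_eqI)
  fix m
  have "bij_betw h {i \<in> A. coeff (F (h i)) m \<noteq> 0} {i \<in> B. coeff (F i) m \<noteq> 0}"
    using assms unfolding bij_betw_def by (auto simp: inj_on_def)
  then show "coeff (formal_sum F B) m = coeff (formal_sum (\<lambda>i. F (h i)) A) m"
    unfolding formal_sum.rep_eq by (rule sum.reindex_bij_betw[symmetric])
qed

text \<open>Fubini: at a fixed monomial only finitely many pairs contribute, and both sides are the
  same finite sum, grouped by the first component.\<close>

lemma formal_sum_Sigma: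
  assumes "locally_finite F (Sigma A B)"
  shows "locally_finite (\<lambda>i. formal_sum (\<lambda>j. F (i, j)) (B i)) A"
    and "formal_sum F (Sigma A B) = formal_sum (\<lambda>i. formal_sum (\<lambda>j. F (i, j)) (B i)) A"
proof -
  let ?G = "\<lambda>i. formal_sum (\<lambda>j. F (i, j)) (B i)"
  let ?S = "\<lambda>m. {x \<in> Sigma A B. coeff (F x) m \<noteq> 0}"
  have fin: "finite (?S m)" for m
    using assms unfolding locally_finite_def by blast
  have fin_fibre: "finite (Pair i -` ?S m)" for i m
    by (rule finite_vimageI[OF fin]) (simp add: inj_on_def)
  have G: "coeff (?G i) m = (\<Sum>j\<in>Pair i -` ?S m. coeff (F (i, j)) m)" if "i \<in> A" for i m
    by (rule coeff_formal_sum[OF fin_fibre]) (use that in auto)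
  \<comment> \<open>An \<open>i\<close> outside the projection of the support has an empty
    fibre.\<close>
  have G0: "coeff (?G i) m = 0" if "i \<in> A" "i \<notin> fst ` ?S m" for i m
  proof -
    have "Pair i -` ?S m = {}"
    proof (rule equals0I)
      fix j assume "j \<in> Pair i -` ?S m"
      then have "(i, j) \<in> ?S m"
        by (rule vimageD)
      then have "i \<in> fst ` ?S m"
        by (rule rev_image_eqI) simp
      with that show False by blast
    qed
    with G[OF that(1), of m] show ?thesis by (simp only: sum.empty)
  qed
  have "finite {i \<in> A. coeff (?G i) m \<noteq> 0}" for m
  proof (rule finite_subset)
    show "{i \<in> A. coeff (?G i) m \<noteq> 0} \<subseteq> fst ` ?S m"
      using G0 by blast
    show "finite (fst ` ?S m)"
      by (rule finite_imageI[OF fin])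
  qed
  then show "locally_finite ?G A"
    unfolding locally_finite_def by simp
  show "formal_sum F (Sigma A B) = formal_sum ?G A"
  proof (rule symfun_eqI)
    fix m
    have "coeff (formal_sum F (Sigma A B)) m = (\<Sum>x\<in>?S m. coeff (F x) m)"
      by (rule coeff_formal_sum[OF fin]) auto
    also have "?S m = Sigma (fst ` ?S m) (\<lambda>i. Pair i -` ?S m)" (is "_ = ?R")
    proof (rule set_eqI)
      fix x show "x \<in> ?S m \<longleftrightarrow> x \<in> ?R"
        by (cases x) (auto simp: image_iff)
    qed
    also have "(\<Sum>x\<in>Sigma (fst ` ?S m) (\<lambda>i. Pair i -` ?S m). coeff (F x) m) =
        (\<Sum>i\<in>fst ` ?S m. \<Sum>j\<in>Pair i -` ?S m. coeff (F (i, j)) m)"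
      by (subst sum.Sigma) (simp_all add: fin fin_fibre split_def del: vimage_Collect_eq)
    also have "\<dots> = (\<Sum>i\<in>fst ` ?S m. coeff (?G i) m)"
      by (rule sum.cong[OF refl], rule G[symmetric]) auto
    also have "\<dots> = coeff (formal_sum ?G A) m"
    proof (rule coeff_formal_sum[symmetric])
      show "finite (fst ` ?S m)"
        by (rule finite_imageI[OF fin])
    qed (use G0 in auto)
    finally show "coeff (formal_sum F (Sigma A B)) m = coeff (formal_sum ?G A) m" .
  qed
qed

text \<open>The fibres of \<open>h\<close> cut \<open>A\<close> into a disjoint union, to which
  Fubini applies once \<open>i\<close> is identified with \<open>(h i, i)\<close>.\<close>

lemma formal_sum_fibres:
  assumes "locally_finite F A" "h ` A \<subseteq> B"
  shows "formal_sum F A = formal_sum (\<lambda>j. formal_sum F {i \<in> A. h i = j}) B"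
proof -
  have bij: "bij_betw snd (Sigma B (\<lambda>j. {i \<in> A. h i = j})) A"
    by (rule bij_betwI[of _ _ _ "\<lambda>i. (h i, i)"]) (use assms in auto)
  have "finite {x \<in> Sigma B (\<lambda>j. {i \<in> A. h i = j}). coeff (F (snd x)) m \<noteq> 0}" for m
  proof (rule finite_subset)
    show "finite ((\<lambda>i. (h i, i)) ` {i \<in> A. coeff (F i) m \<noteq> 0})"
      using assms(1) by (auto simp: locally_finite_def)
  qed auto
  then have "locally_finite (\<lambda>x. F (snd x)) (Sigma B (\<lambda>j. {i \<in> A. h i = j}))"
    by (simp add: locally_finite_def)
  from formal_sum_Sigma(2)[OF this] show ?thesis
    by (simp add: formal_sum_reindex[OF bij])
qed

lemma formal_sum_swap:
  assumes "locally_finite (\<lambda>(i, j). F i j) (A \<times> B)"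
  shows "formal_sum (\<lambda>i. formal_sum (\<lambda>j. F i j) B) A = formal_sum (\<lambda>j. formal_sum (\<lambda>i. F i j) A) B"
proof -
  have bij: "bij_betw prod.swap (B \<times> A) (A \<times> B)"
    by (rule bij_betwI[of _ _ _ prod.swap]) auto
  have "finite {x \<in> B \<times> A. coeff (case x of (j, i) \<Rightarrow> F i j) m \<noteq> 0}" for m
  proof (rule finite_subset)
    show "finite (prod.swap ` {x \<in> A \<times> B. coeff (case x of (i, j) \<Rightarrow> F i j) m \<noteq> 0})"
      using assms by (auto simp: locally_finite_def)
  qed (auto simp: image_iff)
  then have *: "locally_finite (\<lambda>(j, i). F i j) (B \<times> A)"
    by (simp add: locally_finite_def)
  have "formal_sum (\<lambda>(i, j). F i j) (A \<times> B) = formal_sum (\<lambda>(j, i). F i j) (B \<times> A)"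
    by (subst formal_sum_reindex[OF bij]) (auto intro!: formal_sum_cong)
  then show ?thesis
    using formal_sum_Sigma(2)[OF assms] formal_sum_Sigma(2)[OF *] by simp
qed

text \<open>
  Additive maps that are continuous for the product topology, with discrete coefficients.
\<close>

definition finitary :: "(symfun \<Rightarrow> symfun) \<Rightarrow> bool"
  where "finitary H \<longleftrightarrow> (\<forall>f g. H (f + g) = H f + H g) \<and>
    (\<forall>m. \<exists>S. finite S \<and> (\<forall>f. (\<forall>a\<in>S. coeff f a = 0) \<longrightarrow> coeff (H f) m = 0))"

lemma finitaryI:
  assumes "\<And>f g. H (f + g) = H f + H g"
    and "\<And>m. finite (S m)" "\<And>m f. (\<And>a. a \<in> S m \<Longrightarrow> coeff f a = 0) \<Longrightarrow> coeff (H f) m = 0"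
  shows "finitary H"
  unfolding finitary_def
proof (intro conjI allI)
  show "H (f + g) = H f + H g" for f g
    by (rule assms(1))
  show "\<exists>S. finite S \<and> (\<forall>f. (\<forall>a\<in>S. coeff f a = 0) \<longrightarrow> coeff (H f) m = 0)" for m
  proof (intro exI[of _ "S m"] conjI allI impI)
    show "finite (S m)"
      by (rule assms(2))
    show "coeff (H f) m = 0" if "\<forall>a\<in>S m. coeff f a = 0" for f
      by (rule assms(3)) (rule bspec[OF that])
  qed
qed

lemma finitaryE:
  assumes "finitary H"
  obtains S where "finite S" "\<And>f. (\<And>a. a \<in> S \<Longrightarrow> coeff f a = 0) \<Longrightarrow> coeff (H f) m = 0"
proof -
  from assms have "\<exists>S. finite S \<and> (\<forall>f. (\<forall>a\<in>S. coeff f a = 0) \<longrightarrow> coeff (H f) m = 0)"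
    unfolding finitary_def by (elim conjE) (erule spec)
  then show thesis
    by (elim exE conjE) (rule that, assumption, blast)
qed

lemma finitary_add: "finitary H \<Longrightarrow> H (f + g) = H f + H g"
  by (simp add: finitary_def)

lemma finitary_0: "finitary H \<Longrightarrow> H 0 = 0"
  using finitary_add[of H 0 0] by simp

lemma finitary_uminus: "finitary H \<Longrightarrow> H (- f) = - H f"
  using finitary_add[of H f "- f"] finitary_0[of H]
  by (simp add: eq_neg_iff_add_eq_0 add.commute)

lemma finitary_diff: "finitary H \<Longrightarrow> H (f - g) = H f - H g"
  using finitary_add[of H f "- g"] finitary_uminus[of H g] by simp

lemma finitary_sum: "finitary H \<Longrightarrow> H (\<Sum>i\<in>A. F i) = (\<Sum>i\<in>A. H (F i))"
  by (induction A rule: infinite_finite_induct) (auto simp: finitary_add finitary_0)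

text \<open>A coefficient of \<open>H f\<close> depends on finitely many coefficients of
  \<open>f\<close>. On those the infinite sum agrees with a finite partial sum, for which additivity
  suffices.\<close>

lemma finitary_formal_sum:
  assumes "finitary H" "locally_finite F A"
  shows "H (formal_sum F A) = formal_sum (\<lambda>i. H (F i)) A"
proof -
  have *: "\<exists>T. finite T \<and> T \<subseteq> A \<and> (\<forall>i\<in>A - T. coeff (H (F i)) m = 0) \<and>
      coeff (H (formal_sum F A)) m = (\<Sum>i\<in>T. coeff (H (F i)) m)" for m
  proof -
    obtain S where S: "finite S" "\<And>f. (\<And>a. a \<in> S \<Longrightarrow> coeff f a = 0) \<Longrightarrow> coeff (H f) m = 0"
      by (rule finitaryE[OF assms(1), of m]) blast
    \<comment> \<open>\<open>T\<close> gathers the indices whose terms are visible at some monomial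
      in \<open>S\<close>.\<close>
    define T where "T = (\<Union>a\<in>S. {i \<in> A. coeff (F i) a \<noteq> 0})"
    have T: "finite T" "T \<subseteq> A"
      unfolding T_def using assms(2) S(1) by (simp_all add: locally_finite_def UN_subset_iff)
    have T0: "coeff (F i) a = 0" if "a \<in> S" "i \<in> A - T" for a i
      using that by (simp add: T_def)
    have "coeff (formal_sum F A - (\<Sum>i\<in>T. F i)) a = 0" if "a \<in> S" for a
      using coeff_formal_sum[OF T, of F a] T0 that by simp
    then have "coeff (H (formal_sum F A - (\<Sum>i\<in>T. F i))) m = 0"
      by (rule S(2))
    then have "coeff (H (formal_sum F A)) m = (\<Sum>i\<in>T. coeff (H (F i)) m)"
      by (simp add: finitary_diff[OF assms(1)] finitary_sum[OF assms(1)])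
    moreover have "coeff (H (F i)) m = 0" if "i \<in> A - T" for i
      using T0 that by (intro S(2)) blast
    ultimately show ?thesis
      using T by (intro exI[of _ T]) simp
  qed
  show "H (formal_sum F A) = formal_sum (\<lambda>i. H (F i)) A"
  proof (rule symfun_eqI)
    fix m
    obtain T where "finite T" "T \<subseteq> A" "\<forall>i\<in>A - T. coeff (H (F i)) m = 0"
      "coeff (H (formal_sum F A)) m = (\<Sum>i\<in>T. coeff (H (F i)) m)"
      using *[of m] by blast
    then show "coeff (H (formal_sum F A)) m = coeff (formal_sum (\<lambda>i. H (F i)) A) m"
      by (subst coeff_formal_sum[of T A]) auto
  qed
qed

lemma finitary_smult: "finitary (smult c)"
  by (rule finitaryI[where S = "\<lambda>m. {m}"]) (auto simp: smult_simps)

lemma finitary_times: "finitary ((*) g)"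
proof (rule finitaryI[where S = "\<lambda>m. snd ` {(a, b). a + b = m}"])
  show "coeff (g * f) m = 0" if "\<And>a. a \<in> snd ` {(a, b). a + b = m} \<Longrightarrow> coeff f a = 0" for f m
    unfolding coeff_mult
  proof (rule sum.neutral, safe)
    fix a b :: "nat multiset"
    assume "m = a + b"
    then have "b \<in> snd ` {(a, b). a + b = m}"
      by force
    then show "coeff g a * coeff f b = 0"
      by (simp add: that)
  qed
  show "finite (snd ` {(a, b). a + b = m})" for m :: "nat multiset"
    by (intro finite_imageI finite_mset_splittings)
qed (simp add: distrib_left)

text \<open>A monomial has finitely many splittings into two factors, and each factor is met by
  finitely many terms of its family.\<close>

lemma locally_finite_times:
  assumes "locally_finite F A" "locally_finite G B"
  shows "locally_finite (\<lambda>(i, j). F i * G j) (A \<times> B)"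
  unfolding locally_finite_def
proof
  fix m
  let ?P = "{(a, b). a + b = (m :: nat multiset)}"
  let ?T = "\<Union>p\<in>?P. {i \<in> A. coeff (F i) (fst p) \<noteq> 0} \<times> {j \<in> B. coeff (G j) (snd p) \<noteq> 0}"
  have "finite ({i \<in> A. coeff (F i) (fst p) \<noteq> 0} \<times> {j \<in> B. coeff (G j) (snd p) \<noteq> 0})" for p
    using assms unfolding locally_finite_def by (intro finite_cartesian_product) (erule spec)+
  then have "finite ?T"
    by (intro finite_UN_I[OF finite_mset_splittings])
  moreover have "{x \<in> A \<times> B. coeff (case x of (i, j) \<Rightarrow> F i * G j) m \<noteq> 0} \<subseteq> ?T"
  proof
    fix x assume "x \<in> {x \<in> A \<times> B. coeff (case x of (i, j) \<Rightarrow> F i * G j) m \<noteq> 0}"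
    then obtain i j where x: "x = (i, j)" "i \<in> A" "j \<in> B"
      and "(\<Sum>p\<in>?P. coeff (F i) (fst p) * coeff (G j) (snd p)) \<noteq> 0"
      by (cases x) (simp add: coeff_mult split_def)
    then obtain p where "p \<in> ?P" "coeff (F i) (fst p) * coeff (G j) (snd p) \<noteq> 0"
      by (elim sum.not_neutral_contains_not_neutral)
    moreover from this(2) have "coeff (F i) (fst p) \<noteq> 0" "coeff (G j) (snd p) \<noteq> 0"
      by (metis mult_zero_left, metis mult_zero_right)
    ultimately show "x \<in> ?T"
      unfolding x(1) using x(2,3) by (intro UN_I[of p]) simp_all
  qed
  ultimately show "finite {x \<in> A \<times> B. coeff (case x of (i, j) \<Rightarrow> F i * G j) m \<noteq> 0}"
    by (rule finite_subset[rotated])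
qed

text \<open>Multiplication by a fixed series is finitary, so it can be carried into each of the two
  sums in turn.\<close>

lemma formal_sum_times:
  assumes "locally_finite F A" "locally_finite G B"
  shows "formal_sum F A * formal_sum G B = formal_sum (\<lambda>(i, j). F i * G j) (A \<times> B)"
proof -
  have "formal_sum F A * formal_sum G B = formal_sum (\<lambda>i. formal_sum G B * F i) A"
    by (subst mult.commute) (rule finitary_formal_sum[OF finitary_times assms(1)])
  also have "\<dots> = formal_sum (\<lambda>i. formal_sum (\<lambda>j. F i * G j) B) A"
    by (rule formal_sum_cong[OF refl], subst mult.commute)
      (rule finitary_formal_sum[OF finitary_times assms(2)])
  also have "\<dots> = formal_sum (\<lambda>(i, j). F i * G j) (A \<times> B)"
    using formal_sum_Sigma(2)[OF locally_finite_times[OF assms]] by simp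
  finally show ?thesis .
qed

lemma locally_finite_mono:
  assumes "locally_finite F A" "B \<subseteq> A" "\<And>i m. i \<in> B \<Longrightarrow> coeff (F i) m = 0 \<Longrightarrow> coeff (G i) m = 0"
  shows "locally_finite G B"
  unfolding locally_finite_def
proof
  fix m
  have "{i \<in> B. coeff (G i) m \<noteq> 0} \<subseteq> {i \<in> A. coeff (F i) m \<noteq> 0}"
    using assms(2,3) by auto
  then show "finite {i \<in> B. coeff (G i) m \<noteq> 0}"
    by (rule finite_subset) (use assms(1) in \<open>simp add: locally_finite_def\<close>)
qed

lemma locally_finite_smult: "locally_finite F A \<Longrightarrow> locally_finite (\<lambda>i. smult (c i) (F i)) A"
  by (erule locally_finite_mono) auto

lemma formal_sum_add:
  assumes "locally_finite F A" "locally_finite G A"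
  shows "formal_sum (\<lambda>i. F i + G i) A = formal_sum F A + formal_sum G A"
proof (rule symfun_eqI)
  fix m
  let ?S = "{i \<in> A. coeff (F i) m \<noteq> 0} \<union> {i \<in> A. coeff (G i) m \<noteq> 0}"
  have "finite ?S"
    using assms by (auto simp: locally_finite_def)
  then have "coeff (formal_sum H A) m = (\<Sum>i\<in>?S. coeff (H i) m)"
    if "\<And>i. i \<in> A - ?S \<Longrightarrow> coeff (H i) m = 0" for H
    by (rule coeff_formal_sum) (use that in auto)
  then show "coeff (formal_sum (\<lambda>i. F i + G i) A) m = coeff (formal_sum F A + formal_sum G A) m"
    by (simp add: sum.distrib)
qed

lemma formal_sum_uminus: "formal_sum (\<lambda>i. - F i) A = - formal_sum F A"
  by (rule symfun_eqI) (simp add: formal_sum.rep_eq sum_negf)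

lemma formal_sum_diff:
  assumes "locally_finite F A" "locally_finite G A"
  shows "formal_sum (\<lambda>i. F i - G i) A = formal_sum F A - formal_sum G A"
proof -
  have "locally_finite (\<lambda>i. - G i) A"
    using assms(2) by (simp add: locally_finite_def)
  from formal_sum_add[OF assms(1) this] show ?thesis
    by (simp add: formal_sum_uminus)
qed

text \<open>
  This is the common reason why substitution into power series in one variable and into
  symmetric functions is multiplicative: both are sums \<open>\<Sum>m. u\<^sub>m X\<^sup>m\<close> over a monoid of exponents.
\<close>

lemma formal_sum_convolution:
  fixes X :: "'i :: monoid_add \<Rightarrow> symfun"
  assumes "locally_finite X UNIV" and X_add: "\<And>a b. X (a + b) = X a * X b"
    and fin: "\<And>m :: 'i. finite {(a, b). a + b = m}"
  shows "formal_sum (\<lambda>m. smult (\<Sum>(a, b) | a + b = m. u a * v b) (X m)) UNIV =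
    formal_sum (\<lambda>m. smult (u m) (X m)) UNIV * formal_sum (\<lambda>m. smult (v m) (X m)) UNIV"
proof -
  let ?F = "\<lambda>(a, b). smult (u a) (X a) * smult (v b) (X b)"
  have sm: "locally_finite (\<lambda>m. smult (u m) (X m)) UNIV" "locally_finite (\<lambda>m. smult (v m) (X m)) UNIV"
    using assms(1) by (auto intro: locally_finite_smult)
  have "formal_sum (\<lambda>m. smult (u m) (X m)) UNIV * formal_sum (\<lambda>m. smult (v m) (X m)) UNIV =
      formal_sum ?F UNIV"
    using formal_sum_times[OF sm] by simp
  \<comment> \<open>Group the pairs of exponents by their total.\<close>
  also have "\<dots> = formal_sum (\<lambda>m. formal_sum ?F {x \<in> UNIV. (case x of (a, b) \<Rightarrow> a + b) = m}) UNIV"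
    by (rule formal_sum_fibres) (use locally_finite_times[OF sm] in auto)
  also have "\<dots> = formal_sum (\<lambda>m. smult (\<Sum>(a, b) | a + b = m. u a * v b) (X m)) UNIV"
  proof (rule formal_sum_cong)
    fix m :: 'i
    have "{x \<in> UNIV. (case x of (a, b) \<Rightarrow> a + b) = m} = {(a, b). a + b = m}"
      by auto
    then have "formal_sum ?F {x \<in> UNIV. (case x of (a, b) \<Rightarrow> a + b) = m} =
        (\<Sum>x | (case x of (a, b) \<Rightarrow> a + b = m). ?F x)"
      using fin[of m] by (simp add: formal_sum_finite)
    also have "\<dots> = (\<Sum>x | (case x of (a, b) \<Rightarrow> a + b = m). smult (case x of (a, b) \<Rightarrow> u a * v b) (X m))"
      by (rule sum.cong) (auto simp: X_add smult_mult_left smult_mult_right smult_simps mult.commute)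
    finally show "formal_sum ?F {x \<in> UNIV. (case x of (a, b) \<Rightarrow> a + b) = m} =
        smult (\<Sum>(a, b) | a + b = m. u a * v b) (X m)"
      by (simp add: smult_sum_left)
  qed simp
  finally show ?thesis ..
qed

section \<open>Substitution into power series\<close>

text \<open>The filtration by degree, where p_k has degree k and \<open>sum_mset m\<close> is the
  degree of \<open>m\<close>. For a difference of two series it expresses agreement in all degrees
  below \<open>n\<close>.\<close>

definition vanishes_below :: "nat \<Rightarrow> symfun \<Rightarrow> bool"
  where "vanishes_below n f \<longleftrightarrow> (\<forall>m. sum_mset m < n \<longrightarrow> coeff f m = 0)"

lemma vanishes_belowI: "(\<And>m. sum_mset m < n \<Longrightarrow> coeff f m = 0) \<Longrightarrow> vanishes_below n f"
  by (simp add: vanishes_below_def)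

lemma vanishes_belowD: "vanishes_below n f \<Longrightarrow> sum_mset m < n \<Longrightarrow> coeff f m = 0"
  by (simp add: vanishes_below_def)

lemma vanishes_below_0 [simp]: "vanishes_below 0 f"
  by (simp add: vanishes_below_def)

lemma vanishes_below_zero [simp]: "vanishes_below n 0"
  by (simp add: vanishes_below_def)

lemma vanishes_below_mono: "vanishes_below n f \<Longrightarrow> k \<le> n \<Longrightarrow> vanishes_below k f"
  by (simp add: vanishes_below_def)

lemma vanishes_below_1_iff: "vanishes_below 1 f \<longleftrightarrow> coeff f {#} = 0"
proof
  assume "coeff f {#} = 0"
  \<comment> \<open>A non-empty multiset of sum 0 contains 0, and there every series vanishes by the
    choice of the type.\<close>
  moreover have "coeff f m = 0" if "sum_mset m = 0" "m \<noteq> {#}" for m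
    using that by (intro coeff_eq_0) (metis multiset_nonemptyE sum_mset_0_iff)
  ultimately show "vanishes_below 1 f"
    by (intro vanishes_belowI) (metis less_one)
qed (simp add: vanishes_below_def)

lemma vanishes_below_add: "vanishes_below n f \<Longrightarrow> vanishes_below n g \<Longrightarrow> vanishes_below n (f + g)"
  by (simp add: vanishes_below_def)

lemma vanishes_below_diff: "vanishes_below n f \<Longrightarrow> vanishes_below n g \<Longrightarrow> vanishes_below n (f - g)"
  by (simp add: vanishes_below_def)

lemma vanishes_below_smult: "vanishes_below n f \<Longrightarrow> vanishes_below n (smult c f)"
  by (simp add: vanishes_below_def)

lemma vanishes_below_mult:
  assumes "vanishes_below j f" "vanishes_below k g"
  shows "vanishes_below (j + k) (f * g)"
proof (rule vanishes_belowI)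
  fix m :: "nat multiset"
  assume m: "sum_mset m < j + k"
  have "coeff f a * coeff g b = 0" if "a + b = m" for a b
  proof (cases "sum_mset a < j")
    case True
    then show ?thesis
      by (simp add: vanishes_belowD[OF assms(1)])
  next
    case False
    with m have "sum_mset b < k"
      unfolding that[symmetric] by simp
    then show ?thesis
      by (simp add: vanishes_belowD[OF assms(2)])
  qed
  then show "coeff (f * g) m = 0"
    unfolding coeff_mult by (intro sum.neutral) auto
qed

lemma vanishes_below_mult_left: "vanishes_below n f \<Longrightarrow> vanishes_below n (f * g)"
  using vanishes_below_mult[of n f 0 g] by simp

lemma vanishes_below_power: "vanishes_below 1 f \<Longrightarrow> vanishes_below n (f ^ n)"
proof (induction n)
  case (Suc n)
  then show ?case
    using vanishes_below_mult[of 1 f n "f ^ n"] by simp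
qed simp

lemma vanishes_below_formal_sum:
  assumes "\<And>i. i \<in> A \<Longrightarrow> vanishes_below n (F i)"
  shows "vanishes_below n (formal_sum F A)"
proof (rule vanishes_belowI)
  fix m :: "nat multiset"
  assume "sum_mset m < n"
  then have "coeff (F i) m = 0" if "i \<in> A" for i
    using assms that by (auto dest: vanishes_belowD)
  then show "coeff (formal_sum F A) m = 0"
    by (subst coeff_formal_sum[of "{}"]) auto
qed

text \<open>A monomial of degree n is reached only by members starting in degree at most n, and
  these are finite in number.\<close>

lemma locally_finite_of_vanishes_below:
  assumes "\<And>i. i \<in> A \<Longrightarrow> vanishes_below (d i) (F i)" "\<And>n. finite {i \<in> A. d i \<le> n}"
  shows "locally_finite F A"
  unfolding locally_finite_def
proof
  fix m
  have "{i \<in> A. coeff (F i) m \<noteq> 0} \<subseteq> {i \<in> A. d i \<le> sum_mset m}"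
  proof (rule subsetI)
    fix i assume i: "i \<in> {i \<in> A. coeff (F i) m \<noteq> 0}"
    then have "\<not> sum_mset m < d i"
      using vanishes_belowD[OF assms(1), of i m] by blast
    with i show "i \<in> {i \<in> A. d i \<le> sum_mset m}"
      by simp
  qed
  then show "finite {i \<in> A. coeff (F i) m \<noteq> 0}"
    by (rule finite_subset) (rule assms(2))
qed

text \<open>For positive parts the sum bounds both the number of parts and each part; zeros could be
  repeated without bound.\<close>

lemma finite_positive_partitions: "finite {m :: nat multiset. 0 \<notin># m \<and> sum_mset m \<le> n}"
proof (rule finite_subset)
  have bounds: "size m \<le> sum_mset m \<and> (\<forall>i\<in>#m. i \<le> sum_mset m)" if "0 \<notin># m" for m :: "nat multiset"
    using that by (induction m) auto
  show "{m. 0 \<notin># m \<and> sum_mset m \<le> n} \<subseteq> mset ` {xs. set xs \<subseteq> {..n} \<and> length xs \<le> n}"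
  proof (rule subsetI)
    fix m :: "nat multiset"
    assume m: "m \<in> {m. 0 \<notin># m \<and> sum_mset m \<le> n}"
    obtain xs where xs: "mset xs = m"
      using ex_mset by blast
    have "set xs \<subseteq> {..n}" "length xs \<le> n"
      using m bounds[of m] unfolding xs[symmetric] by fastforce+
    with xs show "m \<in> mset ` {xs. set xs \<subseteq> {..n} \<and> length xs \<le> n}"
      by blast
  qed
qed (simp add: finite_lists_length_le)

lemma locally_finite_powers:
  assumes "coeff f {#} = 0"
  shows "locally_finite (\<lambda>n. f ^ n) UNIV"
  by (rule locally_finite_of_vanishes_below[where d = "\<lambda>n. n"])
    (use assms in \<open>simp_all add: vanishes_below_1_iff[symmetric] vanishes_below_power\<close>)

text \<open>The convolution rule with natural numbers as exponents, since a Cauchy product sums over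
  the splittings of \<open>m\<close>.\<close>

lemma fps_subst_mult:
  assumes "coeff f {#} = 0"
  shows "fps_subst (F * G) f = fps_subst F f * fps_subst G f"
proof -
  have eq: "{(a, b). a + b = m} = (\<lambda>i. (i, m - i)) ` {0..m}" for m :: nat
    by force
  have "rat_const (fps_nth (F * G) m) =
      (\<Sum>(a, b) | a + b = m. rat_const (fps_nth F a) * rat_const (fps_nth G b))" for m
    unfolding eq
    by (subst sum.reindex) (simp_all add: inj_on_def fps_mult_nth rat_const_sum rat_const_mult)
  moreover have "finite {(a, b). a + b = m}" for m :: nat
    unfolding eq by simp
  ultimately show ?thesis
    unfolding fps_subst_def
    using formal_sum_convolution[OF locally_finite_powers[OF assms] power_add] by simp
qed

lemma fps_subst_add:
  assumes "coeff f {#} = 0"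
  shows "fps_subst (F + G) f = fps_subst F f + fps_subst G f"
  unfolding fps_subst_def fps_add_nth rat_const_add smult_simps
  by (intro formal_sum_add locally_finite_smult locally_finite_powers assms)

lemma fps_subst_fps_const [simp]: "fps_subst (fps_const c) f = smult (rat_const c) 1"
proof (rule symfun_eqI)
  fix m
  show "coeff (fps_subst (fps_const c) f) m = coeff (smult (rat_const c) 1) m"
    unfolding fps_subst_def by (subst coeff_formal_sum[of "{0}"]) auto
qed

lemma fps_subst_1 [simp]: "fps_subst 1 f = 1"
  using fps_subst_fps_const[of 1 f] by (simp add: smult_simps)

lemma fps_subst_X [simp]: "fps_subst fps_X f = f"
proof (rule symfun_eqI)
  fix m
  show "coeff (fps_subst fps_X f) m = coeff f m"
    unfolding fps_subst_def by (subst coeff_formal_sum[of "{1}"]) (auto simp: fps_X_def)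
qed

lemma fps_subst_power:
  assumes "coeff f {#} = 0"
  shows "fps_subst (F ^ n) f = fps_subst F f ^ n"
  by (induction n) (simp_all add: fps_subst_mult[OF assms])

lemma coeff_fps_subst_Nil:
  assumes "coeff f {#} = 0"
  shows "coeff (fps_subst F f) {#} = rat_const (fps_nth F 0)"
proof -
  have "coeff (f ^ n) {#} = 0" if "n \<noteq> 0" for n
    using that assms by (cases n) auto
  then show ?thesis
    unfolding fps_subst_def by (subst coeff_formal_sum[of "{0}"]) (auto simp: coeff_1)
qed

text \<open>Expand G(f)^n as (G^n)(f) and exchange the sums over n and m. The exchange is legitimate
  because the (n, m) term is zero for m < n and otherwise starts in degree at least m, which is then
  the maximum of the two.\<close>

lemma fps_subst_compose:
  assumes f: "coeff f {#} = 0" and G: "fps_nth G 0 = 0"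
  shows "fps_subst (F oo G) f = fps_subst F (fps_subst G f)"
proof -
  let ?h = "fps_subst G f"
  let ?u = "\<lambda>n m. smult (rat_const (fps_nth F n * fps_nth (G ^ n) m)) (f ^ m)"
  have G0: "fps_nth (G ^ n) m = 0" if "m < n" for m n
    using that G by (rule startsby_zero_power_prefix[rule_format, rotated])
  have "locally_finite (\<lambda>(n, m). ?u n m) (UNIV \<times> UNIV)"
  proof (rule locally_finite_of_vanishes_below[where d = "\<lambda>(n, m). max n m"])
    fix x :: "nat \<times> nat"
    obtain n m where x: "x = (n, m)" by (cases x)
    show "vanishes_below (case x of (n, m) \<Rightarrow> max n m) (case x of (n, m) \<Rightarrow> ?u n m)"
    proof (cases "m < n")
      case True
      then show ?thesis by (simp add: x G0 smult_simps)
    next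
      case False
      then show ?thesis
        using vanishes_below_power[OF vanishes_below_1_iff[THEN iffD2, OF f], of m]
        by (auto simp: x max_def intro: vanishes_below_smult)
    qed
  next
    fix k :: nat
    have "{x \<in> UNIV \<times> UNIV. (case x of (n, m) \<Rightarrow> max n m) \<le> k} \<subseteq> {..k} \<times> {..k}"
      by auto
    then show "finite {x \<in> UNIV \<times> UNIV. (case x of (n, m) \<Rightarrow> max n m) \<le> k}"
      by (rule finite_subset) simp
  qed
  note swap = formal_sum_swap[OF this]
  have "fps_subst F ?h = formal_sum (\<lambda>n. smult (rat_const (fps_nth F n)) (fps_subst (G ^ n) f)) UNIV"
    by (simp add: fps_subst_def[of F] fps_subst_power[OF f])
  also have "\<dots> = formal_sum (\<lambda>n. formal_sum (\<lambda>m. ?u n m) UNIV) UNIV"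
    by (rule formal_sum_cong[OF refl], unfold fps_subst_def,
        subst finitary_formal_sum[OF finitary_smult])
      (intro locally_finite_smult locally_finite_powers f, simp add: smult_simps rat_const_mult)
  also have "\<dots> = formal_sum (\<lambda>m. formal_sum (\<lambda>n. ?u n m) UNIV) UNIV"
    by (rule swap)
  also have "\<dots> = fps_subst (F oo G) f"
    unfolding fps_subst_def
  proof (rule formal_sum_cong[OF refl], rule symfun_eqI)
    fix m l
    have "coeff (formal_sum (\<lambda>n. ?u n m) UNIV) l = (\<Sum>n = 0..m. coeff (?u n m) l)"
      by (rule coeff_formal_sum) (auto simp: G0)
    then show "coeff (formal_sum (\<lambda>n. ?u n m) UNIV) l =
        coeff (smult (rat_const (fps_nth (F oo G) m)) (f ^ m)) l"
      by (simp add: fps_compose_nth rat_const_sum sum_distrib_right)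
  qed
  finally show ?thesis ..
qed

text \<open>log(1 + x) is the compositional inverse of exp(x) - 1, and neither has a constant term,
  so both equations come from composites equal to x.\<close>

lemma fps_subst_exp_ln:
  assumes "coeff f {#} = 0"
  shows "fps_subst (fps_exp 1) (fps_subst (fps_ln 1) f) = 1 + f"
    and "fps_subst (fps_ln 1) (fps_subst (fps_exp 1) f - 1) = f"
proof -
  let ?e = "fps_exp 1 - 1 :: rat fps"
  have e: "fps_nth ?e 0 = 0" "fps_nth ?e 1 \<noteq> 0" and ln: "fps_ln 1 = fps_inv ?e"
    by (simp_all add: fps_ln_fps_exp_inv)
  have inv: "?e oo fps_ln 1 = fps_X" "fps_ln 1 oo ?e = fps_X"
    unfolding ln by (rule fps_inv_right[OF e], rule fps_inv[OF e])
  have e_eq: "fps_subst (fps_exp 1) h = 1 + fps_subst ?e h" if "coeff h {#} = 0" for h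
    using fps_subst_add[OF that, of 1 ?e] by simp
  have "coeff (fps_subst (fps_ln 1) f) {#} = 0"
    by (simp add: coeff_fps_subst_Nil[OF assms])
  then show "fps_subst (fps_exp 1) (fps_subst (fps_ln 1) f) = 1 + f"
    using fps_subst_compose[OF assms, of "fps_ln 1" ?e] by (simp add: e_eq inv)
  show "fps_subst (fps_ln 1) (fps_subst (fps_exp 1) f - 1) = f"
    using fps_subst_compose[OF assms e(1), of "fps_ln 1"] by (simp add: e_eq[OF assms] inv)
qed

text \<open>The sign of \<open>f\<close> is absorbed into the power series, where exp(-x) exp(x) =
  1.\<close>

lemma fps_subst_exp_uminus:
  assumes "coeff f {#} = 0"
  shows "fps_subst (fps_exp 1) (- f) * fps_subst (fps_exp 1) f = 1"
proof -
  have "fps_subst (fps_exp 1) (- f) = fps_subst (fps_exp (- 1)) f"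
    unfolding fps_subst_def
  proof (rule formal_sum_cong[OF refl])
    fix n
    have "(- f) ^ n = smult (rat_const ((- 1) ^ n)) (f ^ n)"
      by (cases "even n") (simp_all add: rat_const_uminus smult_simps)
    then show "smult (rat_const (fps_nth (fps_exp 1) n)) ((- f) ^ n) =
        smult (rat_const (fps_nth (fps_exp (- 1)) n)) (f ^ n)"
      by (simp add: smult_simps rat_const_mult[symmetric])
  qed
  moreover have "fps_exp (- 1) * fps_exp 1 = (1 :: rat fps)"
    by (simp add: fps_exp_add_mult[symmetric])
  ultimately show ?thesis
    by (simp add: fps_subst_mult[OF assms, symmetric])
qed

text \<open>Common to Adams operations, plethysm with a fixed right argument, and the involution t
  -> 1/t. Linearity is over the rationals because some of these maps change t; this is what
  commuting with substitution into rational power series requires.\<close>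

locale symfun_hom =
  fixes H :: "symfun \<Rightarrow> symfun"
  assumes finitary: "finitary H"
    and mult: "H (f * g) = H f * H g"
    and one: "H 1 = 1"
    and rat: "H (smult (rat_const c) f) = smult (rat_const c) (H f)"
begin

lemmas add = finitary_add[OF finitary]
lemmas diff = finitary_diff[OF finitary]
lemmas uminus = finitary_uminus[OF finitary]
lemmas formal_sum = finitary_formal_sum[OF finitary]

lemma power: "H (f ^ n) = H f ^ n"
  by (induction n) (simp_all add: mult one)

lemma fps_subst:
  assumes "coeff f {#} = 0"
  shows "H (fps_subst F f) = fps_subst F (H f)"
  unfolding fps_subst_def
  by (subst formal_sum)
    (intro locally_finite_smult locally_finite_powers assms, simp add: rat power)

end

section \<open>Plethysm\<close>

lemma coeff_adams:
  "coeff (adams k g) m =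
    (if \<forall>i\<in>#m. k dvd i then subst_t (int k) (coeff g (image_mset (\<lambda>i. i div k) m)) else 0)"
  by (simp add: adams.rep_eq)

lemma finitary_adams: "finitary (adams k)"
proof (rule finitaryI[where S = "\<lambda>m. {image_mset (\<lambda>i. i div k) m}"])
  show "adams k (f + g) = adams k f + adams k g" for f g
    by (rule symfun_eqI) (simp add: coeff_adams subst_t_add)
qed (simp_all add: coeff_adams)

lemma adams_smult: "adams k (smult c f) = smult (subst_t (int k) c) (adams k f)"
  by (rule symfun_eqI) (simp add: coeff_adams subst_t_mult)

lemma image_mset_div_mult:
  assumes "\<forall>i\<in>#m. k dvd i"
  shows "image_mset ((*) k) (image_mset (\<lambda>i. i div k) m) = (m :: nat multiset)"
proof -
  have "image_mset (\<lambda>i. k * (i div k)) m = image_mset (\<lambda>i. i) m"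
    by (rule image_mset_cong) (use assms in simp)
  then show ?thesis
    by (simp add: multiset.map_comp comp_def)
qed

lemma image_mset_mult_div:
  "k > 0 \<Longrightarrow> image_mset (\<lambda>i. i div k) (image_mset ((*) k) m) = (m :: nat multiset)"
  by (simp add: multiset.map_comp comp_def)

text \<open>If \<open>k\<close> divides all parts of \<open>m\<close>, the splittings of
  \<open>m\<close> correspond to those of \<open>m\<close> with its parts divided by
  \<open>k\<close>. Otherwise an indivisible part falls into one of the two factors, and both sides
  vanish.\<close>

lemma adams_mult:
  assumes "k > 0"
  shows "adams k (f * g) = adams k f * adams k g"
proof (rule symfun_eqI)
  fix m :: "nat multiset"
  let ?d = "image_mset (\<lambda>i. i div k)" and ?u = "image_mset ((*) k)"
  show "coeff (adams k (f * g)) m = coeff (adams k f * adams k g) m"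
  proof (cases "\<forall>i\<in>#m. k dvd i")
    case True
    have dvd: "(\<forall>i\<in>#a. k dvd i) \<and> (\<forall>i\<in>#b. k dvd i)" if "a + b = m" for a b
      using True unfolding that[symmetric] by auto
    have "coeff (adams k (f * g)) m =
        (\<Sum>(a, b) | a + b = ?d m. subst_t (int k) (coeff f a) * subst_t (int k) (coeff g b))"
      using True by (simp add: coeff_adams coeff_mult subst_t_sum split_def subst_t_mult)
    also have "\<dots> = (\<Sum>(a, b) | a + b = m. coeff (adams k f) a * coeff (adams k g) b)"
    proof (rule sum.reindex_bij_witness[where i = "\<lambda>(a, b). (?d a, ?d b)" and j = "\<lambda>(a, b). (?u a, ?u b)"])
      fix x :: "nat multiset \<times> nat multiset"
      assume x: "x \<in> {(a, b). a + b = ?d m}"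
      obtain a b where ab: "x = (a, b)" "a + b = ?d m"
        using x by (cases x) simp
      have "?u a + ?u b = ?u (?d m)"
        by (simp add: ab(2)[symmetric])
      then have "?u a + ?u b = m"
        by (simp only: image_mset_div_mult[OF True])
      then show "(case x of (a, b) \<Rightarrow> (?u a, ?u b)) \<in> {(a, b). a + b = m}"
        by (simp add: ab(1))
      show "(case (case x of (a, b) \<Rightarrow> (?u a, ?u b)) of (a, b) \<Rightarrow> (?d a, ?d b)) = x"
        by (simp only: ab(1) case_prod_conv image_mset_mult_div[OF assms])
      show "(case (case x of (a, b) \<Rightarrow> (?u a, ?u b)) of (a, b) \<Rightarrow> coeff (adams k f) a * coeff (adams k g) b) =
          (case x of (a, b) \<Rightarrow> subst_t (int k) (coeff f a) * subst_t (int k) (coeff g b))"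
        unfolding ab(1) case_prod_conv coeff_adams image_mset_mult_div[OF assms] by simp
    next
      fix x :: "nat multiset \<times> nat multiset"
      assume x: "x \<in> {(a, b). a + b = m}"
      obtain a b where ab: "x = (a, b)" "a + b = m"
        using x by (cases x) simp
      show "(case x of (a, b) \<Rightarrow> (?d a, ?d b)) \<in> {(a, b). a + b = ?d m}"
        by (simp add: ab(1) ab(2)[symmetric])
      show "(case (case x of (a, b) \<Rightarrow> (?d a, ?d b)) of (a, b) \<Rightarrow> (?u a, ?u b)) = x"
        using dvd[OF ab(2)] by (elim conjE) (simp only: ab(1) case_prod_conv image_mset_div_mult)
    qed
    also have "\<dots> = coeff (adams k f * adams k g) m"
      by (simp add: coeff_mult)
    finally show ?thesis .
  next
    case False
    then obtain i where i: "i \<in># m" "\<not> k dvd i"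
      by blast
    have "coeff (adams k f) a * coeff (adams k g) b = 0" if "a + b = m" for a b
    proof -
      have "i \<in># a \<or> i \<in># b"
        using i(1) unfolding that[symmetric] by simp
      then show ?thesis
      proof
        assume "i \<in># a"
        with i(2) have "coeff (adams k f) a = 0"
          unfolding coeff_adams by (intro if_not_P) blast
        then show ?thesis by simp
      next
        assume "i \<in># b"
        with i(2) have "coeff (adams k g) b = 0"
          unfolding coeff_adams by (intro if_not_P) blast
        then show ?thesis by simp
      qed
    qed
    then have "coeff (adams k f * adams k g) m = 0"
      unfolding coeff_mult by (intro sum.neutral) auto
    moreover have "coeff (adams k (f * g)) m = 0"
      unfolding coeff_adams using False by (intro if_not_P)
    ultimately show ?thesis by simp
  qed
qed

lemma symfun_hom_adams:
  assumes "k > 0"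
  shows "symfun_hom (adams k)"
proof
  have "coeff (adams k 1) m = coeff 1 m" for m
    by (cases "m = {#}") (simp_all add: coeff_adams coeff_1)
  then show "adams k 1 = 1"
    by (rule symfun_eqI)
qed (simp_all add: finitary_adams adams_mult[OF assms] adams_smult)

lemma adams_1 [simp]: "adams (Suc 0) f = f"
  by (rule symfun_eqI) (simp add: coeff_adams)

text \<open>A degenerate index: as \<open>i div 0 = 0\<close>, any coefficient read at a non-empty
  monomial comes from a multiset containing 0, where \<open>f\<close> vanishes. Hence multisets with
  a part 0 contribute nothing to a plethysm.\<close>

lemma adams_0: "coeff f {#} = 0 \<Longrightarrow> adams 0 f = 0"
proof (rule symfun_eqI)
  fix m
  assume f: "coeff f {#} = 0"
  show "coeff (adams 0 f) m = coeff 0 m"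
  proof (cases "m = {#}")
    case False
    then obtain i where "i \<in># m" by blast
    then have "0 \<in># image_mset (\<lambda>i. i div 0) m"
      by auto
    then show ?thesis
      by (simp add: coeff_adams coeff_eq_0)
  qed (simp add: coeff_adams f)
qed

lemma adams_adams:
  assumes "j > 0" "k > 0"
  shows "adams j (adams k f) = adams (j * k) f"
proof (rule symfun_eqI)
  fix m
  have dvd: "j * k dvd i \<longleftrightarrow> j dvd i \<and> k dvd i div j" for i
    using assms by (metis dvd_mult_left dvd_div_iff_mult mult.commute less_numeral_extra(3))
  show "coeff (adams j (adams k f)) m = coeff (adams (j * k) f) m"
    by (auto simp: coeff_adams dvd multiset.map_comp comp_def div_mult2_eq subst_t_subst_t)
qed

lemma vanishes_below_adams:
  assumes "vanishes_below n f"
  shows "vanishes_below (k * n) (adams k f)"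
proof (rule vanishes_belowI)
  fix m :: "nat multiset"
  assume m: "sum_mset m < k * n"
  show "coeff (adams k f) m = 0"
  proof (cases "\<forall>i\<in>#m. k dvd i")
    case True
    have "sum_mset m = k * sum_mset (image_mset (\<lambda>i. i div k) m)"
      by (subst image_mset_div_mult[OF True, symmetric]) (simp add: sum_mset_distrib_left multiset.map_comp comp_def)
    with m have "sum_mset (image_mset (\<lambda>i. i div k) m) < n"
      by simp
    then show ?thesis
      by (simp add: coeff_adams vanishes_belowD[OF assms])
  next
    case False
    then show ?thesis
      unfolding coeff_adams by (rule if_not_P)
  qed
qed

lemma coeff_adams_Nil: "coeff f {#} = 0 \<Longrightarrow> coeff (adams k f) {#} = 0"
  by (simp add: coeff_adams)

lemma vanishes_below_prod_adams:
  assumes "coeff g {#} = 0"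
  shows "vanishes_below (sum_mset m) (\<Prod>k\<in>#m. adams k g)"
proof (induction m)
  case (add k m)
  have "vanishes_below (k * 1) (adams k g)"
    by (rule vanishes_below_adams) (simp only: vanishes_below_1_iff assms)
  with vanishes_below_mult[OF this add.IH] show ?case
    by simp
qed simp

lemma prod_adams_eq_0:
  assumes "coeff g {#} = 0" "0 \<in># m"
  shows "(\<Prod>k\<in>#m. adams k g) = 0"
proof -
  obtain m' where "m = add_mset 0 m'"
    using assms(2) by (rule mset_add)
  then show ?thesis
    by (simp add: adams_0[OF assms(1)])
qed

text \<open>The finiteness behind plethysm: the product over \<open>a\<close> starts in degree
  \<open>sum_mset a\<close> and is zero if \<open>a\<close> contains 0, so only finitely many
  \<open>a\<close> reach \<open>m\<close>.\<close>

lemma coeff_prod_adams_eq_0: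
  assumes "coeff g {#} = 0" "\<not> (0 \<notin># a \<and> sum_mset a \<le> sum_mset m)"
  shows "coeff (\<Prod>k\<in>#a. adams k g) m = 0"
proof (cases "0 \<in># a")
  case True
  then show ?thesis
    by (simp add: prod_adams_eq_0[OF assms(1)])
next
  case False
  with assms(2) show ?thesis
    by (intro vanishes_belowD[OF vanishes_below_prod_adams[OF assms(1)]]) simp
qed

lemma locally_finite_prod_adams:
  assumes "coeff g {#} = 0"
  shows "locally_finite (\<lambda>m. \<Prod>k\<in>#m. adams k g) UNIV"
  unfolding locally_finite_def
proof
  fix m
  show "finite {a \<in> UNIV. coeff (\<Prod>k\<in>#a. adams k g) m \<noteq> 0}"
  proof (rule finite_subset[OF _ finite_positive_partitions])
    show "{a \<in> UNIV. coeff (\<Prod>k\<in>#a. adams k g) m \<noteq> 0} \<subseteq> {a. 0 \<notin># a \<and> sum_mset a \<le> sum_mset m}"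
      using coeff_prod_adams_eq_0[OF assms] by blast
  qed
qed

lemma finitary_plethysm:
  assumes "coeff g {#} = 0"
  shows "finitary (\<lambda>f. f \<circ>\<^sub>p g)"
proof (rule finitaryI[where S = "\<lambda>m. {a. 0 \<notin># a \<and> sum_mset a \<le> sum_mset m}"])
  show "(f + h) \<circ>\<^sub>p g = f \<circ>\<^sub>p g + h \<circ>\<^sub>p g" for f h
    unfolding plethysm_def coeff_add smult_simps
    by (intro formal_sum_add locally_finite_smult locally_finite_prod_adams assms)
  show "finite {a :: nat multiset. 0 \<notin># a \<and> sum_mset a \<le> sum_mset m}" for m :: "nat multiset"
    by (rule finite_positive_partitions)
  fix m f
  assume f: "\<And>a. a \<in> {a. 0 \<notin># a \<and> sum_mset a \<le> sum_mset m} \<Longrightarrow> coeff f a = 0"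
  have "coeff f a * coeff (\<Prod>k\<in>#a. adams k g) m = 0" for a
    using f[of a] coeff_prod_adams_eq_0[OF assms, of a m]
    by (cases "0 \<notin># a \<and> sum_mset a \<le> sum_mset m") simp_all
  then show "coeff (f \<circ>\<^sub>p g) m = 0"
    unfolding plethysm_def by (subst coeff_formal_sum[of "{}"]) simp_all
qed

lemma plethysm_smult:
  assumes "coeff g {#} = 0"
  shows "smult c f \<circ>\<^sub>p g = smult c (f \<circ>\<^sub>p g)"
  unfolding plethysm_def
  by (subst finitary_formal_sum[OF finitary_smult])
    (intro locally_finite_smult locally_finite_prod_adams assms, simp add: smult_simps)

text \<open>The products of Adams operations turn sums of multisets into products, so
  multiplicativity is the convolution rule with multisets as exponents.\<close>

lemma symfun_hom_plethysm:
  assumes "coeff g {#} = 0"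
  shows "symfun_hom (\<lambda>f. f \<circ>\<^sub>p g)"
proof
  show "(f * h) \<circ>\<^sub>p g = f \<circ>\<^sub>p g * (h \<circ>\<^sub>p g)" for f h
    unfolding plethysm_def coeff_mult
    by (rule formal_sum_convolution)
      (simp_all add: locally_finite_prod_adams[OF assms] finite_mset_splittings)
  show "1 \<circ>\<^sub>p g = 1"
  proof (rule symfun_eqI)
    fix m
    show "coeff (1 \<circ>\<^sub>p g) m = coeff 1 m"
      unfolding plethysm_def by (subst coeff_formal_sum[of "{{#}}"]) (simp_all add: coeff_1)
  qed
qed (simp_all add: finitary_plethysm plethysm_smult assms)

lemma plethysm_power_sum:
  assumes "k > 0"
  shows "power_sum k \<circ>\<^sub>p g = adams k g"
proof (rule symfun_eqI)
  fix m
  show "coeff (power_sum k \<circ>\<^sub>p g) m = coeff (adams k g) m"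
    unfolding plethysm_def
    by (subst coeff_formal_sum[of "{{#k#}}"]) (use assms in \<open>simp_all add: coeff_power_sum\<close>)
qed

text \<open>Moves a rescaling of the variables into the right argument. It is applied with h = -g
  for the signs of the suspensions, and with h = t g, where c_k = t^k.\<close>

lemma plethysm_rescale:
  assumes "\<And>k. k > 0 \<Longrightarrow> adams k h = smult (c k) (adams k g)"
  shows "rescale c f \<circ>\<^sub>p g = f \<circ>\<^sub>p h"
  unfolding plethysm_def
proof (rule formal_sum_cong[OF refl])
  fix m
  show "smult (coeff (rescale c f) m) (\<Prod>k\<in>#m. adams k g) = smult (coeff f m) (\<Prod>k\<in>#m. adams k h)"
  proof (cases "0 \<in># m")
    case True
    then show ?thesis
      by (simp add: coeff_eq_0 smult_simps)
  next
    case False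
    then have "(\<Prod>k\<in>#m. adams k h) = smult (\<Prod>k\<in>#m. c k) (\<Prod>k\<in>#m. adams k g)"
      by (induction m)
        (auto simp: assms smult_simps smult_mult_left smult_mult_right mult.commute)
    then show ?thesis
      by (simp add: smult_simps mult.commute)
  qed
qed

lemma coeff_plethysm_Nil:
  assumes "coeff g {#} = 0"
  shows "coeff (f \<circ>\<^sub>p g) {#} = coeff f {#}"
proof -
  have "coeff (smult (coeff f a) (\<Prod>k\<in>#a. adams k g)) {#} = 0" if "a \<noteq> {#}" for a
  proof -
    have "\<not> (0 \<notin># a \<and> sum_mset a \<le> sum_mset {#})"
      using that by (auto simp: sum_mset_0_iff) (metis multiset_nonemptyE)
    then show ?thesis
      using coeff_prod_adams_eq_0[OF assms] by simp
  qed
  then show ?thesis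
    unfolding plethysm_def by (subst coeff_formal_sum[of "{{#}}"]) (simp_all add: coeff_1)
qed

text \<open>Plethysm by \<open>f\<close> from the left does not expand distances in the degree
  filtration: Adams operations with k > 0 do not lower degrees, and a difference of products
  telescopes into multiples of differences of factors.\<close>

lemma vanishes_below_plethysm_diff:
  assumes g: "coeff g {#} = 0" and h: "coeff h {#} = 0" and diff: "vanishes_below n (g - h)"
  shows "vanishes_below n (f \<circ>\<^sub>p g - f \<circ>\<^sub>p h)"
proof -
  have adams: "vanishes_below n (adams k g - adams k h)" for k
  proof (cases "k = 0")
    case True
    then show ?thesis
      by (simp add: adams_0 g h)
  next
    case False
    have "vanishes_below (k * n) (adams k g - adams k h)"
      unfolding finitary_diff[OF finitary_adams, symmetric] by (rule vanishes_below_adams[OF diff])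
    then show ?thesis
      by (rule vanishes_below_mono) (use False in simp)
  qed
  have prod: "vanishes_below n ((\<Prod>k\<in>#m. adams k g) - (\<Prod>k\<in>#m. adams k h))" for m
  proof (induction m)
    case (add k m)
    let ?P = "\<Prod>k\<in>#m. adams k g" and ?Q = "\<Prod>k\<in>#m. adams k h"
    have "adams k g * ?P - adams k h * ?Q = (?P - ?Q) * adams k g + (adams k g - adams k h) * ?Q"
      by (simp add: algebra_simps)
    moreover have "vanishes_below n \<dots>"
      by (intro vanishes_below_add vanishes_below_mult_left add.IH adams)
    ultimately show ?case
      by simp
  qed simp
  have "f \<circ>\<^sub>p g - f \<circ>\<^sub>p h =
      formal_sum (\<lambda>m. smult (coeff f m) ((\<Prod>k\<in>#m. adams k g) - (\<Prod>k\<in>#m. adams k h))) UNIV"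
    unfolding plethysm_def smult_simps
    by (rule formal_sum_diff[symmetric])
      (intro locally_finite_smult locally_finite_prod_adams g h)+
  also have "vanishes_below n \<dots>"
    by (intro vanishes_below_formal_sum vanishes_below_smult prod)
  finally show ?thesis .
qed

lemma vanishes_below_power_sum: "vanishes_below k (power_sum k)"
  by (rule vanishes_belowI) (auto simp: coeff_power_sum)

lemma vanishes_below_fps_subst:
  assumes "fps_nth F 0 = 0" "vanishes_below n f"
  shows "vanishes_below n (fps_subst F f)"
  unfolding fps_subst_def
proof (rule vanishes_below_formal_sum)
  fix i
  show "vanishes_below n (smult (rat_const (fps_nth F i)) (f ^ i))"
    by (cases i) (use assms in \<open>auto simp: smult_simps intro!: vanishes_below_smult vanishes_below_mult_left\<close>)
qed

lemma locally_finite_indexed: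
  assumes "\<And>k. vanishes_below k (F k)"
  shows "locally_finite F {1..}"
proof (rule locally_finite_of_vanishes_below[where d = "\<lambda>k. k"])
  show "finite {i \<in> {1..}. i \<le> n}" for n :: nat
    by (rule finite_subset[of _ "{..n}"]) auto
qed (rule assms)

lemma locally_finite_adams:
  assumes "coeff f {#} = 0"
  shows "locally_finite (\<lambda>k. adams k f) {1..}"
  using vanishes_below_adams[OF vanishes_below_1_iff[THEN iffD2, OF assms]]
  by (intro locally_finite_indexed) simp

section \<open>Plethystic inversion of Comm\<close>

text \<open>The logarithm of the plethystic exponential.\<close>

definition adams_sum :: "symfun \<Rightarrow> symfun"
  where "adams_sum f = formal_sum (\<lambda>k. smult (rat_const (1 / of_nat k)) (adams k f)) {1..}"

lemma coeff_formal_sum_Nil: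
  "(\<And>i. i \<in> A \<Longrightarrow> coeff (F i) {#} = 0) \<Longrightarrow> coeff (formal_sum F A) {#} = 0"
  by (subst coeff_formal_sum[of "{}"]) auto

lemma coeff_adams_sum_Nil: "coeff f {#} = 0 \<Longrightarrow> coeff (adams_sum f) {#} = 0"
  unfolding adams_sum_def by (rule coeff_formal_sum_Nil) (simp add: coeff_adams_Nil)

text \<open>Plethysm by \<open>g\<close> is a homomorphism compatible with infinite sums, so it
  passes through the exponential and acts on each p_k separately.\<close>

lemma Comm_plethysm:
  assumes "coeff g {#} = 0"
  shows "Comm \<circ>\<^sub>p g = fps_subst (fps_exp 1) (adams_sum g) - 1"
proof -
  interpret symfun_hom "\<lambda>f. f \<circ>\<^sub>p g"
    by (rule symfun_hom_plethysm[OF assms])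
  let ?P = "formal_sum (\<lambda>k. smult (rat_const (1 / of_nat k)) (power_sum k)) {1..}"
  have "?P \<circ>\<^sub>p g = adams_sum g"
    unfolding adams_sum_def
  proof (subst formal_sum)
    show "locally_finite (\<lambda>k. smult (rat_const (1 / of_nat k)) (power_sum k)) {1..}"
      by (intro locally_finite_smult locally_finite_indexed vanishes_below_power_sum)
  qed (rule formal_sum_cong, simp_all add: rat plethysm_power_sum)
  moreover have "coeff ?P {#} = 0"
    by (rule coeff_formal_sum_Nil) (simp add: coeff_power_sum)
  ultimately show ?thesis
    unfolding Comm_def diff one by (simp add: fps_subst)
qed

lemma Lie_plethysm:
  assumes "coeff g {#} = 0"
  shows "Lie \<circ>\<^sub>p g = - formal_sum
    (\<lambda>k. smult (rat_const (moebius k / of_nat k)) (fps_subst (fps_ln 1) (- adams k g))) {1..}"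
proof -
  interpret symfun_hom "\<lambda>f. f \<circ>\<^sub>p g"
    by (rule symfun_hom_plethysm[OF assms])
  have "vanishes_below k (- power_sum k)" for k
    using vanishes_below_diff[OF vanishes_below_zero vanishes_below_power_sum] by simp
  then have lf: "locally_finite
      (\<lambda>k. smult (rat_const (moebius k / of_nat k)) (fps_subst (fps_ln 1) (- power_sum k))) {1..}"
    by (intro locally_finite_smult locally_finite_indexed vanishes_below_fps_subst) simp_all
  show ?thesis
    unfolding Lie_def uminus formal_sum[OF lf]
    by (rule arg_cong[of _ _ uminus], rule formal_sum_cong)
      (simp_all add: rat fps_subst coeff_power_sum uminus plethysm_power_sum)
qed

text \<open>Reversing the signs of the variables is plethysm with \<open>- g\<close>. This sign
  cancels the one inside the logarithm, and the outer signs of the suspension and of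
  \<open>Lie\<close> cancel as well.\<close>

lemma suspension_Lie_plethysm:
  assumes "coeff g {#} = 0"
  shows "\<Sigma>\<^sub>1 Lie \<circ>\<^sub>p g = formal_sum
    (\<lambda>k. smult (rat_const (moebius k / of_nat k)) (fps_subst (fps_ln 1) (adams k g))) {1..}"
proof -
  have "rescale (\<lambda>_. - 1) Lie \<circ>\<^sub>p g = Lie \<circ>\<^sub>p (- g)"
    by (rule plethysm_rescale) (simp add: finitary_uminus[OF finitary_adams] smult_simps)
  then show ?thesis
    using assms unfolding suspension_def
    by (simp add: finitary_uminus[OF finitary_plethysm] Lie_plethysm finitary_uminus[OF finitary_adams])
qed

text \<open>Squarefree divisors correspond to sets X of prime divisors, with sign (-1)^|X|. The sum
  over all X expands a product of factors 1 - 1, one per prime, which is empty exactly for n =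
  1.\<close>

lemma sum_moebius_divisors:
  assumes "n > 0"
  shows "(\<Sum>d | d dvd n. moebius d) = (if n = 1 then 1 else 0)"
proof -
  let ?P = "prime_factors n"
  have prod_le: "\<Prod>X dvd n" and primes: "prime_factors (\<Prod>X) = X" and sqf: "squarefree (\<Prod>X)"
    if X: "X \<subseteq> ?P" for X
  proof -
    have fin: "finite X"
      by (rule finite_subset[OF X]) simp
    have prime: "prime p" if "p \<in> X" for p
      using X that by auto
    have "\<Prod>X dvd \<Prod>?P"
      by (rule prod_dvd_prod_subset[OF _ X]) simp
    also have "\<Prod>?P dvd (\<Prod>p\<in>?P. p ^ multiplicity p n)"
      by (rule prod_dvd_prod) (simp add: prime_factors_multiplicity)
    also have "\<dots> = n"
      using prod_prime_factors[of n] assms by simp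
    finally show "\<Prod>X dvd n" .
    have "prime_factorization (\<Prod>X) = mset_set X"
      using prime_factorization_prod_mset_primes[of "mset_set X"] fin prime
      by (simp add: prod_unfold_prod_mset)
    then show "prime_factors (\<Prod>X) = X"
      using fin by simp
    show "squarefree (\<Prod>X)"
    proof (rule squarefree_prod_coprime)
      show "coprime p q" if "p \<in> X" "q \<in> X" "p \<noteq> q" for p q
        using prime that by (intro primes_coprime)
      show "squarefree p" if "p \<in> X" for p
        using prime[OF that] by (rule squarefree_prime)
    qed
  qed
  have prod_primes: "\<Prod>(prime_factors d) = d" if "squarefree d" for d :: nat
  proof -
    have "d \<noteq> 0"
      using that by (metis not_squarefree_0)
    then have "(\<Prod>p\<in>prime_factors d. p ^ multiplicity p d) = \<Prod>(prime_factors d)"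
      using that squarefree_factorial_semiring'[of d] by (intro prod.cong) auto
    then show ?thesis
      using prod_prime_factors[of d] \<open>d \<noteq> 0\<close> by simp
  qed
  have "(\<Sum>d | d dvd n. moebius d) = (\<Sum>d | d dvd n \<and> squarefree d. (- 1) ^ card (prime_factors d))"
    by (rule sum.mono_neutral_cong_right) (use assms in \<open>auto simp: moebius_def\<close>)
  also have "\<dots> = (\<Sum>X\<in>Pow ?P. (- 1) ^ card X)"
  proof (rule sum.reindex_bij_witness[where i = "\<lambda>X. \<Prod>X" and j = prime_factors])
    show "prime_factors d \<in> Pow ?P" if "d \<in> {d. d dvd n \<and> squarefree d}" for d
      using that assms dvd_prime_factors[of n d] by auto
  qed (use prod_le primes sqf prod_primes in auto)
  also have "\<dots> = (\<Prod>p\<in>?P. 1 - 1 :: rat)"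
    by (subst prod_diff_conv_sum) simp_all
  also have "\<dots> = (if n = 1 then 1 else 0)"
    using assms by (auto simp: prime_factorization_empty_iff card_gt_0_iff)
  finally show ?thesis .
qed

text \<open>Moebius inversion for a family depending on the product j k: the terms with j k = n add
  up to \<open>W n\<close> times 1/n times the divisor sum of the Moebius function. The two orders
  of summation serve the two compositions of Comm with its inverse.\<close>

lemma formal_sum_moebius:
  assumes W: "\<And>n. vanishes_below n (W n)"
  defines "T \<equiv> \<lambda>j k. smult (rat_const (moebius k / of_nat (j * k))) (W (j * k))"
  shows "formal_sum (\<lambda>j. formal_sum (\<lambda>k. T j k) {1..}) {1..} = W 1"
    and "formal_sum (\<lambda>k. formal_sum (\<lambda>j. T j k) {1..}) {1..} = W 1"
proof -
  have lf: "locally_finite (\<lambda>(j, k). T j k) ({1..} \<times> {1..})"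
  proof (rule locally_finite_of_vanishes_below[where d = "\<lambda>(j, k). j * k"])
    fix x :: "nat \<times> nat"
    show "vanishes_below (case x of (j, k) \<Rightarrow> j * k) (case x of (j, k) \<Rightarrow> T j k)"
      by (cases x) (simp add: T_def vanishes_below_smult W)
  next
    fix n
    \<comment> \<open>Both indices are at least 1, so a bound on the product bounds each of
      them.\<close>
    have "j \<le> n \<and> k \<le> n" if "1 \<le> j" "1 \<le> k" "j * k \<le> n" for j k :: nat
      using that by (metis le_trans mult.commute mult_le_mono2 nat_mult_1_right)
    then have "{x \<in> {1..} \<times> {1..}. (case x of (j, k) \<Rightarrow> j * k) \<le> n} \<subseteq> {..n} \<times> {..n}"
      by auto
    then show "finite {x \<in> {1..} \<times> {1..}. (case x of (j, k) \<Rightarrow> j * k) \<le> n}"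
      by (rule finite_subset) simp
  qed
  have fibre: "formal_sum (\<lambda>(j, k). T j k) {x \<in> {1..} \<times> {1..}. fst x * snd x = n} =
      (if n = 1 then W 1 else 0)" if n: "n > 0" for n
  proof -
    let ?D = "{x \<in> {1..} \<times> {1..}. fst x * snd x = n}"
    \<comment> \<open>A pair with product \<open>n\<close> is determined by its second entry, an
      arbitrary divisor of \<open>n\<close>.\<close>
    have D: "bij_betw (\<lambda>k. (n div k, k)) {k. k dvd n} ?D"
      by (rule bij_betwI[of _ _ _ snd]) (use n in \<open>auto intro: Suc_leI elim!: dvdE\<close>)
    have "formal_sum (\<lambda>(j, k). T j k) ?D = formal_sum (\<lambda>k. T (n div k) k) {k. k dvd n}"
      by (subst formal_sum_reindex[OF D]) simp
    also have "\<dots> = (\<Sum>k | k dvd n. smult (rat_const (moebius k / of_nat n)) (W n))"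
    proof (subst formal_sum_finite)
      show "finite {k. k dvd n}"
        using n by simp
      show "(\<Sum>k | k dvd n. T (n div k) k) = (\<Sum>k | k dvd n. smult (rat_const (moebius k / of_nat n)) (W n))"
        by (rule sum.cong[OF refl]) (simp only: T_def mem_Collect_eq dvd_div_mult_self)
    qed
    also have "\<dots> = smult (rat_const ((\<Sum>k | k dvd n. moebius k) / of_nat n)) (W n)"
      by (simp add: smult_sum_left[symmetric] rat_const_sum sum_divide_distrib)
    also have "\<dots> = (if n = 1 then W 1 else 0)"
      using n by (simp add: sum_moebius_divisors smult_simps)
    finally show ?thesis .
  qed
  have "formal_sum (\<lambda>(j, k). T j k) ({1..} \<times> {1..}) = formal_sum (\<lambda>n.
      formal_sum (\<lambda>(j, k). T j k) {x \<in> {1..} \<times> {1..}. fst x * snd x = n}) {1..}"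
    by (rule formal_sum_fibres[OF lf]) (auto simp: Suc_le_eq)
  also have "\<dots> = formal_sum (\<lambda>n :: nat. if n = 1 then W 1 else 0) {1..}"
  proof (rule formal_sum_cong[OF refl])
    fix n :: nat
    assume "n \<in> {1..}"
    then show "formal_sum (\<lambda>(j, k). T j k) {x \<in> {1..} \<times> {1..}. fst x * snd x = n} =
        (if n = 1 then W 1 else 0)"
      by (intro fibre) simp
  qed
  also have "\<dots> = W 1"
    by (rule symfun_eqI, subst coeff_formal_sum[of "{1}"]) auto
  finally have W1: "formal_sum (\<lambda>(j, k). T j k) ({1..} \<times> {1..}) = W 1" .
  then show *: "formal_sum (\<lambda>j. formal_sum (\<lambda>k. T j k) {1..}) {1..} = W 1"
    using formal_sum_Sigma(2)[OF lf] by simp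
  then show "formal_sum (\<lambda>k. formal_sum (\<lambda>j. T j k) {1..}) {1..} = W 1"
    using formal_sum_swap[OF lf] by simp
qed

lemma coeff_Comm_Nil [simp]: "coeff Comm {#} = 0"
proof -
  \<comment> \<open>Plethysm by 0 keeps the constant term, which can then be read off from the
    exponential formula.\<close>
  have "coeff (Comm \<circ>\<^sub>p 0) {#} = 0"
    by (subst Comm_plethysm) (simp_all add: coeff_fps_subst_Nil coeff_adams_sum_Nil coeff_1)
  then show ?thesis
    by (simp add: coeff_plethysm_Nil)
qed

lemma coeff_suspension_Lie_Nil [simp]: "coeff (\<Sigma>\<^sub>1 Lie) {#} = 0"
proof -
  have "coeff (\<Sigma>\<^sub>1 Lie \<circ>\<^sub>p 0) {#} = 0"
    by (subst suspension_Lie_plethysm)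
      (simp_all add: coeff_formal_sum_Nil coeff_fps_subst_Nil coeff_adams_Nil)
  then show ?thesis
    by (simp add: coeff_plethysm_Nil)
qed

text \<open>Adams operations multiply their indices, so the logarithm of the plethystic exponential
  of Sigma Lie o f is the double sum of mu(k)/(j k) log(1 + p_(jk) o f). Moebius inversion leaves
  log(1 + f).\<close>

lemma Comm_suspension_Lie:
  assumes f: "coeff f {#} = 0"
  shows "Comm \<circ>\<^sub>p (\<Sigma>\<^sub>1 Lie \<circ>\<^sub>p f) = f"
proof -
  let ?W = "\<lambda>n. fps_subst (fps_ln 1) (adams n f)"
  let ?c = "\<lambda>k. rat_const (moebius k / of_nat k)"
  have f1: "vanishes_below 1 f"
    using f by (simp only: vanishes_below_1_iff)
  have W: "vanishes_below n (?W n)" for n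
    using vanishes_below_adams[OF f1, of n] by (intro vanishes_below_fps_subst) simp_all
  have "adams_sum (\<Sigma>\<^sub>1 Lie \<circ>\<^sub>p f) = formal_sum (\<lambda>j. formal_sum (\<lambda>k.
      smult (rat_const (moebius k / of_nat (j * k))) (?W (j * k))) {1..}) {1..}"
    unfolding adams_sum_def suspension_Lie_plethysm[OF f]
  proof (rule formal_sum_cong[OF refl])
    fix j :: nat
    assume j: "j \<in> {1..}"
    interpret symfun_hom "adams j"
      by (rule symfun_hom_adams) (use j in simp)
    have "adams j (formal_sum (\<lambda>k. smult (?c k) (?W k)) {1..}) =
        formal_sum (\<lambda>k. smult (?c k) (adams j (?W k))) {1..}"
      by (subst formal_sum) (intro locally_finite_smult locally_finite_indexed W, simp add: rat)
    also have "\<dots> = formal_sum (\<lambda>k. smult (?c k) (?W (j * k))) {1..}"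
      by (rule formal_sum_cong[OF refl])
        (use j in \<open>simp add: fps_subst coeff_adams_Nil[OF f] adams_adams\<close>)
    also have "smult (rat_const (1 / of_nat j)) \<dots> =
        formal_sum (\<lambda>k. smult (rat_const (1 / of_nat j)) (smult (?c k) (?W (j * k)))) {1..}"
    proof (rule finitary_formal_sum[OF finitary_smult], intro locally_finite_smult locally_finite_indexed)
      show "vanishes_below k (?W (j * k))" for k
        by (rule vanishes_below_mono[OF W]) (use j in simp)
    qed
    finally show "smult (rat_const (1 / of_nat j)) (adams j (formal_sum (\<lambda>k. smult (?c k) (?W k)) {1..})) =
        formal_sum (\<lambda>k. smult (rat_const (moebius k / of_nat (j * k))) (?W (j * k))) {1..}"
      by (simp add: smult_simps rat_const_mult[symmetric])
  qed
  also have "\<dots> = fps_subst (fps_ln 1) f"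
    using formal_sum_moebius(1)[OF W] by simp
  finally show ?thesis
    by (simp add: Comm_plethysm coeff_plethysm_Nil f fps_subst_exp_ln)
qed

text \<open>Here log(1 + p_k o (Comm o f)) is p_k o \<open>adams_sum f\<close>, since the logarithm
  cancels the exponential. Moebius inversion is then applied to the family p_n o f.\<close>

lemma suspension_Lie_Comm:
  assumes f: "coeff f {#} = 0"
  shows "\<Sigma>\<^sub>1 Lie \<circ>\<^sub>p (Comm \<circ>\<^sub>p f) = f"
proof -
  have f1: "vanishes_below 1 f"
    using f by (simp only: vanishes_below_1_iff)
  have W: "vanishes_below n (adams n f)" for n
    using vanishes_below_adams[OF f1, of n] by simp
  have "\<Sigma>\<^sub>1 Lie \<circ>\<^sub>p (Comm \<circ>\<^sub>p f) = formal_sum (\<lambda>k. formal_sum (\<lambda>j.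
      smult (rat_const (moebius k / of_nat (j * k))) (adams (j * k) f)) {1..}) {1..}"
  proof (subst suspension_Lie_plethysm)
    show "formal_sum (\<lambda>k. smult (rat_const (moebius k / of_nat k))
        (fps_subst (fps_ln 1) (adams k (Comm \<circ>\<^sub>p f)))) {1..} = formal_sum (\<lambda>k. formal_sum (\<lambda>j.
      smult (rat_const (moebius k / of_nat (j * k))) (adams (j * k) f)) {1..}) {1..}"
    proof (rule formal_sum_cong[OF refl])
      fix k :: nat
      assume k: "k \<in> {1..}"
      interpret symfun_hom "adams k"
        by (rule symfun_hom_adams) (use k in simp)
      have "fps_subst (fps_ln 1) (adams k (Comm \<circ>\<^sub>p f)) = adams k (adams_sum f)"
        by (simp add: Comm_plethysm[OF f] diff one fps_subst coeff_adams_sum_Nil[OF f]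
            fps_subst_exp_ln coeff_adams_Nil)
      also have "\<dots> = formal_sum (\<lambda>j. smult (rat_const (1 / of_nat j)) (adams (j * k) f)) {1..}"
        unfolding adams_sum_def
      proof (subst formal_sum)
        show "locally_finite (\<lambda>j. smult (rat_const (1 / of_nat j)) (adams j f)) {1..}"
          by (intro locally_finite_smult locally_finite_indexed W)
      qed (rule formal_sum_cong[OF refl], use k in \<open>simp add: rat adams_adams mult.commute\<close>)
      also have "smult (rat_const (moebius k / of_nat k)) \<dots> = formal_sum (\<lambda>j.
          smult (rat_const (moebius k / of_nat k)) (smult (rat_const (1 / of_nat j)) (adams (j * k) f))) {1..}"
      proof (rule finitary_formal_sum[OF finitary_smult], intro locally_finite_smult locally_finite_indexed)
        show "vanishes_below j (adams (j * k) f)" for j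
          by (rule vanishes_below_mono[OF W]) (use k in simp)
      qed
      finally show "smult (rat_const (moebius k / of_nat k)) (fps_subst (fps_ln 1) (adams k (Comm \<circ>\<^sub>p f))) =
          formal_sum (\<lambda>j. smult (rat_const (moebius k / of_nat (j * k))) (adams (j * k) f)) {1..}"
        by (simp add: smult_simps rat_const_mult[symmetric] mult.commute)
    qed
  qed (simp add: coeff_plethysm_Nil f)
  also have "\<dots> = f"
    using formal_sum_moebius(2)[OF W] by simp
  finally show ?thesis .
qed

section \<open>Hollow hypertrees and the inverse of Pasc\<close>

lemma symfun_eq_of_vanishes_below:
  assumes "\<And>n. vanishes_below n (f - g)"
  shows "f = g"
proof (rule symfun_eqI)
  fix m
  show "coeff f m = coeff g m"
    using vanishes_belowD[OF assms[of "Suc (sum_mset m)"], of m] by simp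
qed

text \<open>Banach's fixed point theorem for the degree filtration: the iterates from 0 stabilise
  degree by degree, and their limit is the fixed point.\<close>

lemma contraction_fixed_point:
  assumes const: "\<And>f. coeff f {#} = 0 \<Longrightarrow> coeff (\<Phi> f) {#} = 0"
    and contr: "\<And>n f g. coeff f {#} = 0 \<Longrightarrow> coeff g {#} = 0 \<Longrightarrow>
      vanishes_below n (f - g) \<Longrightarrow> vanishes_below (Suc n) (\<Phi> f - \<Phi> g)"
  shows "\<exists>!f. coeff f {#} = 0 \<and> f = \<Phi> f"
proof -
  define x where "x n = (\<Phi> ^^ n) 0" for n
  have x_Suc: "x (Suc n) = \<Phi> (x n)" for n
    by (simp add: x_def)
  have x_const: "coeff (x n) {#} = 0" for n
    by (induction n) (simp_all add: x_def const)
  have x_step: "vanishes_below n (x (n + k) - x n)" for n k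
  proof (induction n)
    case (Suc n)
    then show ?case
      using contr[of "x (n + k)" "x n" n] by (simp add: x_const x_Suc)
  qed simp
  \<comment> \<open>The iterate \<open>x n\<close> is known to be stable only in degrees strictly
    below \<open>n\<close>, hence the successor.\<close>
  define z where "z = Symfun (\<lambda>m. coeff (x (Suc (sum_mset m))) m)"
  have z: "coeff z m = coeff (x (Suc (sum_mset m))) m" for m
    unfolding z_def by (subst Symfun_inverse) (auto simp: coeff_eq_0)
  have z_const: "coeff z {#} = 0"
    by (simp add: z x_const)
  have z_x: "vanishes_below n (z - x n)" for n
  proof (rule vanishes_belowI)
    fix m :: "nat multiset"
    assume "sum_mset m < n"
    then obtain k where "n = Suc (sum_mset m) + k"
      using less_iff_Suc_add by auto
    then show "coeff (z - x n) m = 0"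
      using vanishes_belowD[OF x_step[of "Suc (sum_mset m)" k], of m] by (simp add: z)
  qed
  have "z = \<Phi> z"
  proof (rule symfun_eq_of_vanishes_below)
    fix n
    \<comment> \<open>As \<open>x (Suc n) = \<Phi> (x n)\<close>, the iterates cancel and
      \<open>z - \<Phi> z\<close> remains.\<close>
    have "vanishes_below (Suc n) ((z - x (Suc n)) - (\<Phi> z - \<Phi> (x n)))"
      by (intro vanishes_below_diff z_x contr z_const x_const)
    then show "vanishes_below n (z - \<Phi> z)"
      by (simp add: x_Suc vanishes_below_mono)
  qed
  \<comment> \<open>Each application of \<open>\<Phi>\<close> pushes the difference of two fixed
    points up by one degree.\<close>
  moreover have "f = z" if f: "coeff f {#} = 0" "f = \<Phi> f" for f
  proof (rule symfun_eq_of_vanishes_below)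
    show "vanishes_below n (f - z)" for n
    proof (induction n)
      case (Suc n)
      from contr[OF f(1) z_const this] show ?case
        by (simp only: f(2)[symmetric] \<open>z = \<Phi> z\<close>[symmetric])
    qed simp
  qed
  ultimately show ?thesis
    using z_const by blast
qed

section \<open>The equation of hollow hypertrees\<close>

lemma coeff_power_sum_Nil [simp]: "coeff (power_sum k) {#} = 0"
  by (simp add: coeff_power_sum)

definition hypertree_map :: "symfun \<Rightarrow> symfun"
  where "hypertree_map Z =
    \<Sigma>\<^sub>1 Lie \<circ>\<^sub>p (power_sum 1 + power_sum 1 * (Comm \<circ>\<^sub>p smult (t_power 1) Z))"

text \<open>The factor p_1 raises degrees by one and the plethysms inside and outside it do not
  lower them, so the map is a contraction.\<close>

lemma hypertree_map_unique_fixed_point: "\<exists>!Z. coeff Z {#} = 0 \<and> Z = hypertree_map Z"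
proof (rule contraction_fixed_point)
  show "coeff (hypertree_map f) {#} = 0" for f
    unfolding hypertree_map_def by (subst coeff_plethysm_Nil) simp_all
next
  fix n f g
  assume f: "coeff f {#} = 0" and g: "coeff g {#} = 0" and fg: "vanishes_below n (f - g)"
  let ?C = "\<lambda>f. Comm \<circ>\<^sub>p smult (t_power 1) f" and ?p = "power_sum 1"
  have "vanishes_below n (?C f - ?C g)"
    by (rule vanishes_below_plethysm_diff)
      (simp_all only: f g coeff_smult mult_zero_right smult_simps(8)[symmetric] vanishes_below_smult[OF fg])
  then have "vanishes_below (Suc n) (?p * (?C f - ?C g))"
    using vanishes_below_mult[OF vanishes_below_power_sum[of 1]] by simp
  moreover have "?p * (?C f - ?C g) = (?p + ?p * ?C f) - (?p + ?p * ?C g)"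
    by (simp add: algebra_simps)
  ultimately have "vanishes_below (Suc n) ((?p + ?p * ?C f) - (?p + ?p * ?C g))"
    by (simp only:)
  then show "vanishes_below (Suc n) (hypertree_map f - hypertree_map g)"
    unfolding hypertree_map_def by (intro vanishes_below_plethysm_diff) simp_all
qed

text \<open>Applying Comm from the left removes Sigma Lie, and applying Sigma Lie restores it. Both
  inversions apply because \<open>Z\<close> and the right-hand side have no constant term.\<close>

lemma hypertree_map_fixed_point_iff:
  assumes Z: "coeff Z {#} = 0"
  shows "Z = hypertree_map Z \<longleftrightarrow>
    Comm \<circ>\<^sub>p Z = power_sum 1 * (1 + Comm \<circ>\<^sub>p smult (t_power 1) Z)"
    (is "_ \<longleftrightarrow> _ = ?R")
proof -
  have R: "coeff ?R {#} = 0"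
    by simp
  have eq: "hypertree_map Z = \<Sigma>\<^sub>1 Lie \<circ>\<^sub>p ?R"
    by (simp add: hypertree_map_def distrib_left)
  show ?thesis
    unfolding eq using Comm_suspension_Lie[OF R] suspension_Lie_Comm[OF Z] by metis
qed

section \<open>Rescaling of variables and the involution t -> 1/t\<close>

lemma finitary_rescale: "finitary (rescale c)"
  by (rule finitaryI[where S = "\<lambda>m. {m}"])
    (auto intro: symfun_eqI simp: distrib_left)

lemma rescale_mult: "rescale c (f * g) = rescale c f * rescale c g"
proof (rule symfun_eqI)
  fix m
  have "(\<Prod>i\<in>#m. c i) * (coeff f a * coeff g b) =
      (\<Prod>i\<in>#a. c i) * coeff f a * ((\<Prod>i\<in>#b. c i) * coeff g b)" if "a + b = m" for a b
    unfolding that[symmetric] by (simp add: algebra_simps)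
  then show "coeff (rescale c (f * g)) m = coeff (rescale c f * rescale c g) m"
    by (auto simp: coeff_mult sum_distrib_left intro!: sum.cong)
qed

lemma rescale_1 [simp]: "rescale c 1 = 1"
  by (rule symfun_eqI) (simp add: coeff_1)

lemma rescale_smult: "rescale c (smult d f) = smult d (rescale c f)"
  by (rule symfun_eqI) (simp add: mult_ac)

lemma rescale_rescale: "rescale c (rescale d f) = rescale (\<lambda>i. c i * d i) f"
proof (rule symfun_eqI)
  fix m
  have "(\<Prod>i\<in>#m. c i * d i) = (\<Prod>i\<in>#m. c i) * (\<Prod>i\<in>#m. d i)"
    by (induction m) (simp_all add: mult_ac)
  then show "coeff (rescale c (rescale d f)) m = coeff (rescale (\<lambda>i. c i * d i) f) m"
    by (simp add: mult_ac)
qed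

lemma prod_mset_t_power: "(\<Prod>i\<in>#m. t_power (int i)) = t_power (int (sum_mset m))"
  by (induction m) (simp_all add: t_power_mult)

definition t_inversion :: "symfun \<Rightarrow> symfun"
  where "t_inversion f = rescale (\<lambda>i. t_power (int i)) (subst_t_coeffs (- 1) f)"

lemma coeff_t_inversion:
  "coeff (t_inversion f) m = t_power (int (sum_mset m)) * subst_t (- 1) (coeff f m)"
  by (simp add: t_inversion_def prod_mset_t_power)

lemma t_inversion_smult: "t_inversion (smult c f) = smult (subst_t (- 1) c) (t_inversion f)"
  by (rule symfun_eqI) (simp add: coeff_t_inversion subst_t_mult mult_ac)

text \<open>In degree d the second pass turns the factor t^d of the first into t^(-d) and multiplies
  by t^d again.\<close>

lemma t_inversion_involutive [simp]: "t_inversion (t_inversion f) = f"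
  by (rule symfun_eqI)
    (simp add: coeff_t_inversion subst_t_mult subst_t_subst_t mult.assoc[symmetric])

interpretation t_inversion: symfun_hom t_inversion
proof
  show "finitary t_inversion"
    by (rule finitaryI[where S = "\<lambda>m. {m}"])
      (auto intro: symfun_eqI simp: coeff_t_inversion subst_t_add distrib_left)
  have "subst_t_coeffs (- 1) (f * g) = subst_t_coeffs (- 1) f * subst_t_coeffs (- 1) g" for f g
    by (rule symfun_eqI) (simp add: coeff_mult subst_t_sum split_def subst_t_mult)
  then show "t_inversion (f * g) = t_inversion f * t_inversion g" for f g
    by (simp add: t_inversion_def rescale_mult)
  show "t_inversion 1 = 1"
    by (rule symfun_eqI) (simp add: coeff_t_inversion coeff_1)
qed (simp add: t_inversion_smult)

text \<open>Dividing the parts of \<open>m\<close> by \<open>k\<close> divides its degree by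
  \<open>k\<close>, and t -> t^k makes up for this in the power of t.\<close>

lemma t_inversion_adams: "t_inversion (adams k f) = adams k (t_inversion f)"
proof (rule symfun_eqI)
  fix m
  show "coeff (t_inversion (adams k f)) m = coeff (adams k (t_inversion f)) m"
  proof (cases "\<forall>i\<in>#m. k dvd i")
    case True
    have "sum_mset m = k * sum_mset (image_mset (\<lambda>i. i div k) m)"
      by (subst image_mset_div_mult[OF True, symmetric])
        (simp add: sum_mset_distrib_left multiset.map_comp comp_def)
    with True show ?thesis
      by (simp add: coeff_t_inversion coeff_adams subst_t_mult subst_t_subst_t mult.commute)
  qed (auto simp: coeff_t_inversion coeff_adams)
qed

text \<open>By the exponential formula, plethysm by Comm is built from Adams operations, rational
  scalars and the exponential, all compatible with the involution.\<close>

lemma t_inversion_Comm_plethysm: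
  assumes f: "coeff f {#} = 0"
  shows "t_inversion (Comm \<circ>\<^sub>p f) = Comm \<circ>\<^sub>p t_inversion f"
proof -
  have "t_inversion (adams_sum f) = adams_sum (t_inversion f)"
    unfolding adams_sum_def
    by (subst t_inversion.formal_sum)
      (intro locally_finite_smult locally_finite_adams f,
        simp add: t_inversion.rat t_inversion_adams)
  moreover have "coeff (t_inversion f) {#} = 0"
    by (simp add: coeff_t_inversion f)
  ultimately show ?thesis
    by (simp add: Comm_plethysm f t_inversion.diff t_inversion.one t_inversion.fps_subst
        coeff_adams_sum_Nil)
qed

section \<open>The equation of the plethystic inverse of suspended Pasc\<close>

text \<open>The signs of the two suspensions cancel in the second factor of Pasc; the first becomes
  E o (-L) with E = 1 + Comm. Multiplication by E o L clears it, as the exponentials are mutually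
  inverse.\<close>

lemma suspension_Pasc_plethysm:
  assumes L: "coeff L {#} = 0"
  shows "smult (t_power 1) (\<Sigma>\<^sub>1 Pasc \<circ>\<^sub>p L) * (1 + Comm \<circ>\<^sub>p L) = Comm \<circ>\<^sub>p smult (t_power 1) L"
proof -
  interpret plethysm: symfun_hom "\<lambda>f. f \<circ>\<^sub>p L"
    by (rule symfun_hom_plethysm[OF L])
  let ?E = "rescale (\<lambda>_. - 1) (1 + Comm)" and ?C = "rescale (\<lambda>i. t_power (int i)) Comm"
  have "\<Sigma>\<^sub>1 Pasc = smult (t_power (- 1)) (?E * ?C)"
    by (simp add: suspension_def Pasc_def suspension_t_def rescale_mult rescale_smult
        rescale_rescale finitary_uminus[OF finitary_rescale] smult_simps smult_mult_right)
  then have "\<Sigma>\<^sub>1 Pasc \<circ>\<^sub>p L = smult (t_power (- 1)) ((?E \<circ>\<^sub>p L) * (?C \<circ>\<^sub>p L))"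
    by (simp only: plethysm_smult[OF L] plethysm.mult)
  moreover have "?C \<circ>\<^sub>p L = Comm \<circ>\<^sub>p smult (t_power 1) L"
    by (rule plethysm_rescale) (simp add: adams_smult)
  moreover have "(?E \<circ>\<^sub>p L) * (1 + Comm \<circ>\<^sub>p L) = 1"
  proof -
    have "?E \<circ>\<^sub>p L = (1 + Comm) \<circ>\<^sub>p (- L)"
      by (rule plethysm_rescale) (simp add: finitary_uminus[OF finitary_adams] smult_simps)
    also have "\<dots> = fps_subst (fps_exp 1) (- adams_sum L)"
    proof -
      interpret neg: symfun_hom "\<lambda>f. f \<circ>\<^sub>p (- L)"
        by (rule symfun_hom_plethysm) (simp add: L)
      have "adams_sum (- L) = - adams_sum L"
        unfolding adams_sum_def
        by (simp add: finitary_uminus[OF finitary_adams] smult_simps formal_sum_uminus)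
      then show ?thesis
        by (simp add: neg.add neg.one Comm_plethysm L)
    qed
    finally show ?thesis
      using fps_subst_exp_uminus[OF coeff_adams_sum_Nil[OF L]] by (simp add: Comm_plethysm[OF L])
  qed
  moreover have "(?E \<circ>\<^sub>p L) * (?C \<circ>\<^sub>p L) * (1 + Comm \<circ>\<^sub>p L) =
      (?E \<circ>\<^sub>p L) * (1 + Comm \<circ>\<^sub>p L) * (?C \<circ>\<^sub>p L)"
    by (simp only: mult_ac)
  ultimately show ?thesis
    by (simp only: smult_t_power_cancel mult_1_left)
qed

text \<open>Every link of the chain is reversible: scaling by t, multiplying by the unit 1 + Comm o
  L, and applying the involution, which exchanges the arguments t L and L for Z and t Z.\<close>

lemma plethysm_inverse_iff_fixed_point:
  assumes L: "coeff L {#} = 0"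
  defines "Z \<equiv> smult (t_power (- 1)) (t_inversion L)"
  shows "\<Sigma>\<^sub>1 Pasc \<circ>\<^sub>p L = power_sum 1 \<longleftrightarrow> Z = hypertree_map Z"
proof -
  let ?t = "t_power 1"
  have Z: "coeff Z {#} = 0"
    by (simp add: Z_def coeff_t_inversion L)
  have inv_L: "t_inversion L = smult ?t Z"
    by (simp add: Z_def smult_t_power_cancel)
  have inv_tL: "t_inversion (smult ?t L) = Z"
    by (simp add: Z_def t_inversion_smult)
  \<comment> \<open>The scalar t becomes t^(-1), which cancels the t from p_1 -> t p_1.\<close>
  have inv_p: "t_inversion (smult ?t (power_sum 1)) = power_sum 1"
    by (rule symfun_eqI)
      (simp add: coeff_t_inversion coeff_power_sum t_power_mult)
  have unit: "(1 + Comm \<circ>\<^sub>p L) * fps_subst (fps_exp 1) (- adams_sum L) = 1"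
    using fps_subst_exp_uminus[OF coeff_adams_sum_Nil[OF L]]
    by (simp add: Comm_plethysm[OF L] mult.commute)
  have cancel: "f * (1 + Comm \<circ>\<^sub>p L) = g * (1 + Comm \<circ>\<^sub>p L) \<longleftrightarrow> f = g" for f g
    by (metis unit mult.assoc mult.right_neutral)
  have "\<Sigma>\<^sub>1 Pasc \<circ>\<^sub>p L = power_sum 1 \<longleftrightarrow>
      smult ?t (\<Sigma>\<^sub>1 Pasc \<circ>\<^sub>p L) = smult ?t (power_sum 1)"
    using smult_t_power_cancel(2)[of 1] by metis
  also have "\<dots> \<longleftrightarrow> Comm \<circ>\<^sub>p smult ?t L = smult ?t (power_sum 1) * (1 + Comm \<circ>\<^sub>p L)"
    unfolding suspension_Pasc_plethysm[OF L, symmetric] by (rule cancel[symmetric])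
  also have "\<dots> \<longleftrightarrow> t_inversion (Comm \<circ>\<^sub>p smult ?t L) =
      t_inversion (smult ?t (power_sum 1) * (1 + Comm \<circ>\<^sub>p L))"
    by (metis t_inversion_involutive)
  also have "\<dots> \<longleftrightarrow> Comm \<circ>\<^sub>p Z = power_sum 1 * (1 + Comm \<circ>\<^sub>p smult ?t Z)"
    by (simp only: t_inversion.mult t_inversion.add t_inversion.one inv_p inv_L inv_tL
        t_inversion_Comm_plethysm coeff_smult L mult_zero_right)
  also have "\<dots> \<longleftrightarrow> Z = hypertree_map Z"
    by (rule hypertree_map_fixed_point_iff[OF Z, symmetric])
  finally show ?thesis .
qed

theorem proposition3p17:
  shows "Zh_SigmaLie =
      smult (t_power (- 1)) (rescale (\<lambda>i. t_power (int i)) (subst_t_coeffs (- 1) \<Lambda>)) \<and>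
    smult (t_power (- 1)) (rescale (\<lambda>i. t_power (int i)) (subst_t_coeffs (- 1) \<Lambda>)) =
      \<Sigma>\<^sub>1 (\<Sigma>\<^sub>t (subst_t_coeffs (- 1) \<Lambda>))"
proof
  let ?P = "\<lambda>L. coeff L {#} = 0 \<and> \<Sigma>\<^sub>1 Pasc \<circ>\<^sub>p L = power_sum 1"
  let ?Q = "\<lambda>Z. coeff Z {#} = 0 \<and> Z = hypertree_map Z"
  let ?\<phi> = "\<lambda>L. smult (t_power (- 1)) (t_inversion L)"
  have PQ: "?P L \<longleftrightarrow> ?Q (?\<phi> L)" for L
  proof -
    \<comment> \<open>One direction is direct; the other applies the map a second time to return to
      \<open>L\<close>.\<close>
    have "coeff (?\<phi> L) {#} = 0 \<longleftrightarrow> coeff L {#} = 0"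
    proof
      assume "coeff (?\<phi> L) {#} = 0"
      then have "coeff (?\<phi> (?\<phi> L)) {#} = 0"
        by (auto simp: coeff_t_inversion subst_t_mult)
      then show "coeff L {#} = 0"
        by (simp add: t_inversion_smult smult_simps t_power_mult)
    qed (simp add: coeff_t_inversion)
    then show ?thesis
      using plethysm_inverse_iff_fixed_point[of L] by blast
  qed
  have \<phi>\<phi>: "?\<phi> (?\<phi> f) = f" for f
    by (simp add: t_inversion_smult smult_simps t_power_mult)
  have Q: "?Q Zh_SigmaLie"
    using theI'[OF hypertree_map_unique_fixed_point]
    unfolding Zh_SigmaLie_def hypertree_map_def .
  \<comment> \<open>The map is its own inverse, so existence and uniqueness pass from the hypertree
    equation to the plethystic inverse, and the description defining \<open>\<Lambda>\<close> is
    meaningful.\<close>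
  have "\<exists>!L. ?P L"
  proof (rule ex1I[of _ "?\<phi> Zh_SigmaLie"])
    show "?P (?\<phi> Zh_SigmaLie)"
      unfolding PQ \<phi>\<phi> by (rule Q)
    show "L = ?\<phi> Zh_SigmaLie" if "?P L" for L
    proof -
      have "?\<phi> L = Zh_SigmaLie"
        using that Q hypertree_map_unique_fixed_point unfolding PQ by blast
      with \<phi>\<phi>[of L] show ?thesis by simp
    qed
  qed
  then have "?P \<Lambda>"
    unfolding Lambda_def by (rule theI')
  then have "?\<phi> \<Lambda> = Zh_SigmaLie"
    using Q hypertree_map_unique_fixed_point unfolding PQ by blast
  then show "Zh_SigmaLie =
      smult (t_power (- 1)) (rescale (\<lambda>i. t_power (int i)) (subst_t_coeffs (- 1) \<Lambda>))"
    by (simp add: t_inversion_def)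
  \<comment> \<open>The second equality is formal: (-1)(-t^i) = t^i on the variables, and the two
    outer signs cancel to leave t^(-1).\<close>
  show "smult (t_power (- 1)) (rescale (\<lambda>i. t_power (int i)) (subst_t_coeffs (- 1) \<Lambda>)) =
      \<Sigma>\<^sub>1 (\<Sigma>\<^sub>t (subst_t_coeffs (- 1) \<Lambda>))"
    by (simp add: suspension_def suspension_t_def rescale_smult rescale_rescale
        finitary_uminus[OF finitary_rescale] smult_simps)
qed

end
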